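(* Let $G$ be a $3$-colorable planar graph. Then $\vec{\chi}(G)\leq 10$. Moreover, if $G$ is outerplanar, then $\vec{\chi}(G)\leq 9$.
   Context: Graphs are finite and simple. A proper orientation $D$ of a graph $G$ is an orientation of the edges of $G$ such that $d_D^+(u)\neq d_D^+(v)$ for every edge $uv\in E(G)$, where $d_D^+$ denotes out-degree in $D$. The proper orientation number $\vec{\chi}(G)$ is the minimum of $\Delta^+(D)$ (the maximum out-degree of $D$) over all proper orientations $D$ of $G$. *)

theory Defs
  imports "HOL-Analysis.Analysis" "Graph_Theory.Pair_Digraph"
begin

text \<open>
  A finite simple graph is a \<open>pair_graph\<close>: a finite loop-free digraph without parallel
  arcs whose arc set is symmetric, so that an edge \<open>uv\<close> is the pair of opposite arcs
  \<open>(u,v)\<close>, \<open>(v,u)\<close>. An orientation is again a \<open>pair_pre_digraph\<close>, on the same vertices,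
  and keeps exactly one arc of each such pair.
\<close>

definition orientation_of :: "'a pair_pre_digraph \<Rightarrow> 'a pair_pre_digraph \<Rightarrow> bool" where
  "orientation_of G D \<longleftrightarrow>
     pverts D = pverts G \<and> parcs D \<union> (parcs D)\<inverse> = parcs G \<and> parcs D \<inter> (parcs D)\<inverse> = {}"

definition proper_orientation :: "'a pair_pre_digraph \<Rightarrow> 'a pair_pre_digraph \<Rightarrow> bool" where
  "proper_orientation G D \<longleftrightarrow>
     orientation_of G D \<and> (\<forall>(u, v) \<in> parcs G. out_degree D u \<noteq> out_degree D v)"

text \<open>The \<open>0\<close> only matters for the graph without vertices.\<close>

definition max_out_degree :: "'a pair_pre_digraph \<Rightarrow> nat" where
  "max_out_degree D = Max (insert 0 (out_degree D ` pverts D))"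

definition proper_orientation_number :: "'a pair_pre_digraph \<Rightarrow> nat" where
  "proper_orientation_number G = (LEAST k. \<exists>D. proper_orientation G D \<and> max_out_degree D = k)"

definition colorable :: "nat \<Rightarrow> 'a pair_pre_digraph \<Rightarrow> bool" where
  "colorable k G \<longleftrightarrow>
     (\<exists>c :: 'a \<Rightarrow> nat. (\<forall>v \<in> pverts G. c v < k) \<and> (\<forall>(u, v) \<in> parcs G. c u \<noteq> c v))"

definition edges_of :: "'a pair_pre_digraph \<Rightarrow> 'a set set" where
  "edges_of G = (\<lambda>(u, v). {u, v}) ` parcs G"

text \<open>
  The plane is \<open>complex\<close>. Vertices are drawn as distinct points and each undirected edge as
  a simple arc joining its two ends and containing no other vertex; two edges meet at most
  in common ends.
\<close>

definition plane_drawing ::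
    "'a pair_pre_digraph \<Rightarrow> ('a \<Rightarrow> complex) \<Rightarrow> ('a set \<Rightarrow> real \<Rightarrow> complex) \<Rightarrow> bool" where
  "plane_drawing G p \<gamma> \<longleftrightarrow>
     inj_on p (pverts G) \<and>
     (\<forall>e \<in> edges_of G. arc (\<gamma> e) \<and> {pathstart (\<gamma> e), pathfinish (\<gamma> e)} = p ` e \<and>
        path_image (\<gamma> e) \<inter> p ` pverts G = p ` e) \<and>
     (\<forall>e \<in> edges_of G. \<forall>f \<in> edges_of G. e \<noteq> f \<longrightarrow>
        path_image (\<gamma> e) \<inter> path_image (\<gamma> f) \<subseteq> p ` (e \<inter> f))"

definition drawing_image ::
    "'a pair_pre_digraph \<Rightarrow> ('a \<Rightarrow> complex) \<Rightarrow> ('a set \<Rightarrow> real \<Rightarrow> complex) \<Rightarrow> complex set" where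
  "drawing_image G p \<gamma> = p ` pverts G \<union> (\<Union>e \<in> edges_of G. path_image (\<gamma> e))"

definition planar :: "'a pair_pre_digraph \<Rightarrow> bool" where
  "planar G \<longleftrightarrow> (\<exists>p \<gamma>. plane_drawing G p \<gamma>)"

text \<open>
  The image of a drawing is compact, so its complement has exactly one unbounded component;
  \<open>outside\<close> is that component, the outer face. Outerplanar: some drawing has every vertex
  on the boundary of the outer face.
\<close>

definition outerplanar :: "'a pair_pre_digraph \<Rightarrow> bool" where
  "outerplanar G \<longleftrightarrow>
     (\<exists>p \<gamma>. plane_drawing G p \<gamma> \<and> p ` pverts G \<subseteq> frontier (outside (drawing_image G p \<gamma>)))"

end

theory Submission
  imports Defs
begin

text \<open>
  Let \<open>K = 2\<close> in the planar and \<open>K = 1\<close> in the outerplanar case. Between disjoint vertex sets \<open>A\<close>, \<open>B\<close> a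
  planar graph has at most \<open>2 (|A| + |B|)\<close> edges and an outerplanar one at most \<open>2 |A| + |B|\<close>. By
  Hakimi's theorem there is hence an orientation whose out-degrees on the three colour classes
  are at most \<open>K + 2\<close>, \<open>4\<close> and \<open>K\<close>. Among the orientations obeying relaxed bounds we take one that
  maximizes a weighted sum of out-degrees, fix some vertices of the first two classes at the
  out-degrees \<open>K + 5\<close>, \<open>K + 6\<close>, \<open>K + 8\<close>, put the vertices of the third class of large remaining
  degree at \<open>K + 7\<close>, and settle all others in stages, at out-degrees \<open>K + 4, K + 3, \<dots>, 0\<close>.

  The edge bounds follow from Euler's inequality, which rests on Janiszewski's theorem and the
  Jordan curve theorem: an arc that closes a cycle increases the number of faces, an arc lies on
  the boundary of at most two faces, and a face of a bipartite drawing with at least four edges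
  has at least four edges on its boundary.
\<close>

subsection \<open>Orientations built in stages\<close>

text \<open>Repairing one bad edge of an orientation disturbs others, so vertices are fixed for good
  at a prescribed out-degree. This is safe if adjacent vertices are never fixed at the same level
  and all others are kept away from it. Above \<open>K + 4\<close>, level \<open>K + 6\<close>
  belongs to the second class only, \<open>K + 7\<close> to the third and \<open>K + 8\<close> to
  the first; a clash is possible only at \<open>K + 5\<close>, which serves the first two. A vertex
  of the first class is therefore put at \<open>K + 5\<close> only if each of its neighbours of
  degree \<open>K + 5\<close> in the second class has had an out-arc reversed, which pushes that
  neighbour down to \<open>K + 4\<close> or less. The capacities \<open>K + 2\<close>,
  \<open>4\<close>, \<open>K\<close> arise by splitting the edges between subsets \<open>X1\<close>,
  \<open>X2\<close>, \<open>X3\<close> of the classes into two bipartite graphs,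
  \<open>X1 \<union> X2\<close> against \<open>X3\<close> and \<open>X2\<close> against
  \<open>X1\<close>, and adding their edge bounds: the coefficients are 4, 4, 2 in the planar and 3,
  4, 1 in the outerplanar case.\<close>

definition orients :: "'a rel \<Rightarrow> 'a rel \<Rightarrow> bool" where
  "orients E D \<longleftrightarrow> D \<union> D\<inverse> = E \<and> D \<inter> D\<inverse> = {}"

text \<open>The tool for fixing a set \<open>F\<close> of vertices: \<open>B\<close> decides the
  edges that touch \<open>F\<close>, and \<open>D\<close> orients the rest independently.\<close>

lemma orients_glue:
  assumes "sym E"
    and B: "B \<subseteq> E" "\<And>u v. (u, v) \<in> B \<Longrightarrow> u \<in> F \<or> v \<in> F"
    and total: "\<And>u v. (u, v) \<in> E \<Longrightarrow> u \<in> F \<or> v \<in> F \<Longrightarrow> (u, v) \<in> B \<longleftrightarrow> (v, u) \<notin> B"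
    and D: "orients (E \<inter> (- F) \<times> (- F)) D"
  shows "orients E (D \<union> B)"
proof -
  have DE: "D \<subseteq> E \<inter> (- F) \<times> (- F)"
    using D by (auto simp: orients_def)
  have "D \<union> D\<inverse> = E \<inter> (- F) \<times> (- F)" "D \<inter> D\<inverse> = {}"
    using D by (auto simp: orients_def)
  then have D1: "\<And>u v. (u, v) \<in> E \<Longrightarrow> u \<notin> F \<Longrightarrow> v \<notin> F \<Longrightarrow> (u, v) \<in> D \<or> (v, u) \<in> D"
    and D2: "\<And>u v. (u, v) \<in> D \<Longrightarrow> (v, u) \<notin> D" by blast+
  have sy: "\<And>u v. (u, v) \<in> E \<Longrightarrow> (v, u) \<in> E" using \<open>sym E\<close> by (meson symD)
  show ?thesis unfolding orients_def
  proof (intro conjI equalityI subsetI)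
    fix x assume "x \<in> (D \<union> B) \<union> (D \<union> B)\<inverse>"
    then show "x \<in> E" using DE B(1) sy by auto
  next
    fix x assume x: "x \<in> E"
    obtain u v where uv: "x = (u, v)" by (cases x)
    show "x \<in> (D \<union> B) \<union> (D \<union> B)\<inverse>"
      using x uv total[of u v] D1[of u v] by (cases "u \<in> F \<or> v \<in> F") auto
  next
    fix x assume x: "x \<in> (D \<union> B) \<inter> (D \<union> B)\<inverse>"
    obtain u v where uv: "x = (u, v)" by (cases x)
    have 1: "(u, v) \<in> D \<union> B" "(v, u) \<in> D \<union> B" using x uv by auto
    show "x \<in> {}"
    proof (cases "u \<in> F \<or> v \<in> F")
      case True
      then have "(u, v) \<in> B" "(v, u) \<in> B" using 1 DE by auto
      then show ?thesis using total[of u v] B(1) True by auto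
    next
      case False
      then have "(u, v) \<in> D" "(v, u) \<in> D" using 1 B(2) by blast+
      then show ?thesis using D2 by blast
    qed
  qed auto
qed

lemma card_Image_glue:
  assumes "finite E" "D \<subseteq> E \<inter> (- F) \<times> (- F)" "B \<subseteq> E" "\<And>u v. (u, v) \<in> B \<Longrightarrow> u \<in> F \<or> v \<in> F"
  shows "card ((D \<union> B) `` {v}) = card (D `` {v}) + card (B `` {v})"
proof -
  have "finite (D `` {v})" "finite (B `` {v})"
    using assms by (meson finite_Image finite_subset le_inf_iff)+
  moreover have "D `` {v} \<inter> B `` {v} = {}" using assms(2,4) by blast
  ultimately show ?thesis by (simp add: Un_Image card_Un_disjoint)
qed

text \<open>
  Condition on a vertex with \<open>c\<close> out-arcs already fixed and \<open>a\<close>, \<open>b\<close> undecided neighbours in the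
  class that is served first, respectively second, at stage \<open>j\<close>; the two classes swap roles from
  each stage to the next, starting at \<open>j = K + 4\<close>.
\<close>

definition stage_inv :: "nat \<Rightarrow> nat \<Rightarrow> nat \<Rightarrow> nat \<Rightarrow> nat \<Rightarrow> bool" where
  "stage_inv K j c a b \<longleftrightarrow> c + a + b \<le> j \<or> c \<le> K \<and>
     (j = K + 4 \<and> c + a + b \<le> K + 6 \<or> j = K + 3 \<and> b \<le> 1 \<and> c + a + b \<le> K + 6 \<or>
      j = K + 2 \<and> a \<le> 1 \<and> b \<le> 2 \<or> j = K + 1 \<and> b = 0 \<and> a \<le> 2)"

text \<open>If the vertex can still reach \<open>Suc j\<close>, the last assumption gives
  \<open>a' \<le> c + a + b - (j + 2)\<close>. In the first alternative of \<open>stage_inv\<close>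
  this is impossible. In the others, with \<open>c \<le> K\<close>, it yields
  \<open>a' \<le> 1\<close>, \<open>a' \<le> 2\<close>, \<open>a' = 0\<close>, \<open>a' = 0\<close>
  for \<open>Suc j\<close> equal to \<open>K + 4\<close>, \<open>K + 3\<close>,
  \<open>K + 2\<close>, \<open>K + 1\<close>. After the last of these \<open>b' = 0\<close> too, so
  only \<open>c \<le> K\<close> remains.\<close>

lemma stage_inv_step:
  assumes "stage_inv K (Suc j) c a b" "a' \<le> a" "b' \<le> b"
    and "Suc j \<le> c + a + b \<Longrightarrow> c \<le> Suc j \<Longrightarrow> a' + (Suc j - c + 1) \<le> a + b"
  shows "stage_inv K j c b' a'"
proof (cases "Suc j \<le> c + a + b")
  case False
  then show ?thesis using assms(2,3) by (auto simp: stage_inv_def)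
next
  case True
  have "c \<le> Suc j" using assms(1) by (auto simp: stage_inv_def)
  with True assms(4) have "a' + (Suc j - c + 1) \<le> a + b" by blast
  with assms(1-3) \<open>c \<le> Suc j\<close> show ?thesis unfolding stage_inv_def by (elim disjE conjE) auto
qed

text \<open>
  At stage \<open>j\<close> a maximal set \<open>W \<subseteq> Z\<close> is fixed at out-degree \<open>j\<close> through the arcs \<open>T\<close>, in such a way
  that no neighbour of \<open>W\<close> can reach \<open>j\<close> any more; then the vertices of \<open>P\<close>, and after them those of
  \<open>Q\<close>, that can still reach \<open>j\<close> are fixed at \<open>j\<close>. Maximality of \<open>W\<close> gives a vertex of \<open>Z - W\<close> so many
  neighbours that are fixed now that the invariant survives.
\<close>

lemma staged_orientation:
  fixes E :: "'a rel" and c :: "'a \<Rightarrow> nat"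
  assumes "finite E" "finite Z" "sym E" "E \<subseteq> (P \<union> Q \<union> Z) \<times> (P \<union> Q \<union> Z)"
    and "P \<inter> Q = {}" "P \<inter> Z = {}" "Q \<inter> Z = {}"
    and "E \<inter> P \<times> P = {}" "E \<inter> Q \<times> Q = {}" "E \<inter> Z \<times> Z = {}"
    and "\<And>v. v \<in> P \<union> Q \<Longrightarrow> c v + card (E `` {v}) \<le> j"
    and "\<And>z. z \<in> Z \<Longrightarrow> stage_inv K j (c z) (card (E `` {z} \<inter> P)) (card (E `` {z} \<inter> Q))"
  shows "\<exists>D. orients E D \<and> (\<forall>v \<in> P \<union> Q \<union> Z. c v + card (D `` {v}) \<le> j) \<and>
    (\<forall>(u, v) \<in> E. c u + card (D `` {u}) \<noteq> c v + card (D `` {v}))"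
  using assms
proof (induction j arbitrary: E c P Q Z)
  case 0
  have "E `` {v} = {}" if "v \<in> P \<union> Q \<union> Z" for v
  proof (cases "v \<in> Z")
    case True
    have "E `` {v} = (E `` {v} \<inter> P) \<union> (E `` {v} \<inter> Q)"
      using "0.prems"(4,10) True by blast
    moreover have "card (E `` {v} \<inter> P) = 0" "card (E `` {v} \<inter> Q) = 0"
      using "0.prems"(12)[OF True] by (auto simp: stage_inv_def)
    moreover have "finite (E `` {v})" using "0.prems"(1) by (rule finite_Image)
    ultimately show ?thesis by (metis Un_empty card_0_eq finite_Int)
  next
    case False
    then have "card (E `` {v}) = 0" using "0.prems"(11)[of v] that by auto
    moreover have "finite (E `` {v})" using "0.prems"(1) by (rule finite_Image)
    ultimately show ?thesis by simp
  qed
  then have E: "E = {}" using "0.prems"(4) by blast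
  have "c v = 0" if "v \<in> P \<union> Q \<union> Z" for v
    using that "0.prems"(11)[of v] "0.prems"(12)[of v] by (auto simp: stage_inv_def)
  then show ?case using E by (intro exI[of _ "{}"]) (auto simp: orients_def)
next
  case (Suc j)
  note finE = Suc.prems(1) and finZ = Suc.prems(2) and symE = Suc.prems(3) and EV = Suc.prems(4)
    and disj = Suc.prems(5,6,7) and indP = Suc.prems(8) and indQ = Suc.prems(9) and indZ = Suc.prems(10)
    and low = Suc.prems(11) and inv = Suc.prems(12)
  define N where "N v = E `` {v}" for v
  define m where "m v = c v + card (N v)" for v
  have finN: "finite (N v)" for v using finE unfolding N_def by (rule finite_Image)
  have symN: "w \<in> N v \<longleftrightarrow> v \<in> N w" for v w using symE unfolding N_def by (auto dest: symD)
  have E_N: "(v, w) \<in> E \<longleftrightarrow> w \<in> N v" for v w unfolding N_def by auto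
  have NZ: "N z \<subseteq> P \<union> Q" if "z \<in> Z" for z using that EV indZ unfolding N_def by blast
  have mlow: "m v \<le> Suc j" if "v \<in> P \<union> Q" for v using low[OF that] unfolding m_def N_def .
  have mZ: "m z = c z + card (N z \<inter> P) + card (N z \<inter> Q)" if "z \<in> Z" for z
  proof -
    have "N z = (N z \<inter> P) \<union> (N z \<inter> Q)" using NZ[OF that] by blast
    moreover have "card ((N z \<inter> P) \<union> (N z \<inter> Q)) = card (N z \<inter> P) + card (N z \<inter> Q)"
      using disj finN by (intro card_Un_disjoint) auto
    ultimately show ?thesis unfolding m_def by simp
  qed
  \<comment> \<open>\<open>m w\<close> is the largest out-degree still open to \<open>w\<close>, and
    an arc of \<open>T\<close> ending in \<open>w\<close> lowers it by one. So the last clause keeps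
    every neighbour of \<open>W\<close> below \<open>Suc j\<close>.\<close>
  define valid where "valid = (\<lambda>(W, T). W \<subseteq> Z \<and> T \<subseteq> E \<and> Domain T \<subseteq> W \<and>
     (\<forall>z \<in> W. c z + card (T `` {z}) = Suc j) \<and>
     (\<forall>z \<in> W. \<forall>w \<in> N z. (z, w) \<notin> T \<longrightarrow> m w \<le> j \<or> w \<in> Range T))"
  have "valid ({}, {})" unfolding valid_def by auto
  moreover have "\<forall>y. valid y \<longrightarrow> card (fst y) < Suc (card Z)"
    using finZ unfolding valid_def by (auto intro!: le_imp_less_Suc card_mono)
  ultimately have "\<exists>x. valid x \<and> (\<forall>y. valid y \<longrightarrow> card (fst y) \<le> card (fst x))"
    by (rule ex_has_greatest_nat)
  then obtain W T where WT: "valid (W, T)"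
    and max: "\<And>W' T'. valid (W', T') \<Longrightarrow> card W' \<le> card W" by force
  have WZ: "W \<subseteq> Z" and TE: "T \<subseteq> E" and TW: "Domain T \<subseteq> W"
    and Tcard: "\<And>z. z \<in> W \<Longrightarrow> c z + card (T `` {z}) = Suc j"
    and Tcov: "\<And>z w. z \<in> W \<Longrightarrow> w \<in> N z \<Longrightarrow> (z, w) \<notin> T \<Longrightarrow> m w \<le> j \<or> w \<in> Range T"
    using WT unfolding valid_def by auto
  have finW: "finite W" using WZ finZ finite_subset by blast
  define C where "C z = {w \<in> N z. m w = Suc j \<and> w \<notin> Range T}" for z
  \<comment> \<open>With at most \<open>Suc j - c z\<close> such neighbours, \<open>z\<close> could
    send arcs to all of them, reach exactly \<open>Suc j\<close> and join \<open>W\<close>.\<close>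
  have Cbig: "Suc j - c z + 1 \<le> card (C z)" if z: "z \<in> Z" "z \<notin> W" and "Suc j \<le> m z" "c z \<le> Suc j" for z
  proof (rule ccontr)
    assume "\<not> ?thesis"
    then have "card (C z) \<le> Suc j - c z" by simp
    moreover have "Suc j - c z \<le> card (N z)" using \<open>Suc j \<le> m z\<close> unfolding m_def by simp
    moreover have "C z \<subseteq> N z" unfolding C_def by auto
    ultimately obtain S where S: "C z \<subseteq> S" "S \<subseteq> N z" "card S = Suc j - c z"
      using exists_subset_between[of "C z" "Suc j - c z" "N z"] finN by blast
    define T' where "T' = T \<union> {z} \<times> S"
    have "z \<notin> Domain T" using z TW by blast
    then have im1: "T' `` {z} = S" unfolding T'_def by auto
    have im2: "T' `` {v} = T `` {v}" if "v \<noteq> z" for v using that unfolding T'_def by auto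
    have v1: "insert z W \<subseteq> Z" using z WZ by auto
    have v2: "T' \<subseteq> E" using TE S(2) unfolding T'_def N_def by auto
    have v3: "Domain T' \<subseteq> insert z W" using TW unfolding T'_def by auto
    have v4: "c v + card (T' `` {v}) = Suc j" if "v \<in> insert z W" for v
      using that Tcard[of v] im2[of v] S(3) im1 \<open>c z \<le> Suc j\<close> by (cases "v = z") auto
    have v5: "m w \<le> j \<or> w \<in> Range T'" if "v \<in> insert z W" "w \<in> N v" "(v, w) \<notin> T'" for v w
    proof (cases "v = z")
      case True
      have "m w \<le> Suc j" using NZ z that True mlow by blast
      moreover have "w \<notin> C z" using that True S(1) unfolding T'_def by auto
      ultimately have "m w \<le> j \<or> w \<in> Range T" using that True unfolding C_def by auto
      then show ?thesis unfolding T'_def by auto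
    next
      case False
      then show ?thesis using Tcov[of v w] that unfolding T'_def by auto
    qed
    have "valid (insert z W, T')" unfolding valid_def prod.case
      by (intro conjI ballI impI; (rule v1 v2 v3 v4 v5; assumption?))
    then have "card (insert z W) \<le> card W" by (rule max)
    then show False using z finW by simp
  qed
  \<comment> \<open>A vertex with \<open>m w = Suc j\<close> reaches this level only if all its
    undecided edges become out-arcs. A vertex of \<open>Q\<close> adjacent to \<open>PF\<close>
    receives an arc from there and drops below the level.\<close>
  define PF where "PF = {w \<in> P. m w = Suc j \<and> w \<notin> Range T}"
  define QF where "QF = {w \<in> Q. m w = Suc j \<and> w \<notin> Range T \<and> N w \<inter> PF = {}}"
  define F where "F = W \<union> PF \<union> QF"
  define B where "B = T \<union> {(v, z). (v, z) \<in> E \<and> z \<in> W \<and> (z, v) \<notin> T} \<union> {(v, w). (v, w) \<in> E \<and> v \<in> PF \<union> QF}"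
  have PQF: "v \<in> P \<union> Q \<and> m v = Suc j \<and> v \<notin> Range T" if "v \<in> PF \<union> QF" for v
    using that unfolding PF_def QF_def by auto
  have noWPQ: "v \<notin> N z" if "z \<in> W" "v \<in> PF \<union> QF" for v z
  proof
    assume "v \<in> N z"
    moreover have "(z, v) \<notin> T" using PQF[OF that(2)] by auto
    ultimately have "m v \<le> j \<or> v \<in> Range T" using Tcov that(1) by blast
    then show False using PQF[OF that(2)] by auto
  qed
  have indF: "w \<notin> F" if "v \<in> F" "w \<in> N v" for v w
  proof
    assume w: "w \<in> F"
    have vw: "(v, w) \<in> E" using that unfolding N_def by simp
    have 1: "\<not> (v \<in> Z \<and> w \<in> Z)" "\<not> (v \<in> P \<and> w \<in> P)" "\<not> (v \<in> Q \<and> w \<in> Q)" using vw indZ indP indQ by auto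
    have 2: "\<not> (v \<in> W \<and> w \<in> PF \<union> QF)" "\<not> (w \<in> W \<and> v \<in> PF \<union> QF)"
      using noWPQ that symN by blast+
    have 3: "\<not> (v \<in> PF \<and> w \<in> QF)" "\<not> (w \<in> PF \<and> v \<in> QF)"
      using that(2) symN[of w v] unfolding QF_def by blast+
    have 4: "PF \<subseteq> P" "QF \<subseteq> Q" unfolding PF_def QF_def by auto
    show False using that(1) w 1 2 3 4 WZ unfolding F_def by blast
  qed
  have BE: "B \<subseteq> E" using TE unfolding B_def by auto
  have BF: "u \<in> F \<or> v \<in> F" if "(u, v) \<in> B" for u v
    using that TW unfolding B_def F_def by auto
  have tot: "(u, v) \<in> B \<longleftrightarrow> (v, u) \<notin> B" if uv: "(u, v) \<in> E" and F: "u \<in> F \<or> v \<in> F" for u v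
  proof -
    have vu: "(v, u) \<in> E" using uv symE by (meson symD)
    have key: "(u, v) \<in> B \<longleftrightarrow> (v, u) \<notin> B" if "u \<in> F" "(u, v) \<in> E" "(v, u) \<in> E" for u v
    proof -
      have vF: "v \<notin> F" using indF[OF that(1)] that(2) E_N by blast
      have vW: "v \<notin> W" "v \<notin> PF" "v \<notin> QF" using vF unfolding F_def by auto
      have vT: "(v, u) \<notin> T" using TW vW by auto
      show ?thesis
      proof (cases "u \<in> W")
        case True
        then have "u \<notin> PF" "u \<notin> QF" using WZ disj unfolding PF_def QF_def by auto
        then show ?thesis using True vW vT that unfolding B_def by auto
      next
        case False
        then have "u \<in> PF \<union> QF" using that(1) unfolding F_def by auto
        then have "(u, v) \<in> B" using that unfolding B_def by auto
        moreover have "(v, u) \<notin> B" using vT vW False unfolding B_def by auto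
        ultimately show ?thesis by blast
      qed
    qed
    show ?thesis using F key uv vu by blast
  qed
  define E' where "E' = E \<inter> (- F) \<times> (- F)"
  define c' where "c' v = c v + card (B `` {v})" for v
  have BN: "B `` {v} \<subseteq> N v" for v using BE unfolding N_def by auto
  have E'N: "E' `` {v} \<subseteq> N v" for v unfolding E'_def N_def by auto
  have BF': "B `` {v} \<subseteq> F" if "v \<notin> F" for v using BF that by blast
  \<comment> \<open>Each decided arc into \<open>v\<close> is one potential out-arc lost.\<close>
  have m'le: "c' v + card (E' `` {v}) + card {f. (f, v) \<in> B} \<le> m v" if v: "v \<notin> F" for v
  proof -
    let ?A = "{f. (f, v) \<in> B}"
    have A: "?A \<subseteq> N v \<inter> F" using BE BF v symN E_N by blast
    have d1: "B `` {v} \<inter> E' `` {v} = {}" using BF'[OF v] unfolding E'_def by auto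
    have d2: "(B `` {v} \<union> E' `` {v}) \<inter> ?A = {}"
    proof -
      have "(v, f) \<notin> B" if "(f, v) \<in> B" for f using tot[of f v] that BE BF by blast
      moreover have "E' `` {v} \<inter> F = {}" unfolding E'_def by auto
      ultimately show ?thesis using A by blast
    qed
    have fin: "finite (B `` {v})" "finite (E' `` {v})" "finite ?A"
      using A by (auto intro: finite_subset[OF BN finN] finite_subset[OF E'N finN] finite_subset[of _ "N v", OF _ finN])
    then have "card (B `` {v}) + card (E' `` {v}) + card ?A = card (B `` {v} \<union> E' `` {v} \<union> ?A)"
      using d1 d2 by (simp add: card_Un_disjoint)
    also have "\<dots> \<le> card (N v)" using BN E'N A finN by (intro card_mono) auto
    finally show ?thesis unfolding c'_def m_def by simp
  qed
  have finA: "finite {f. (f, v) \<in> B}" for v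
  proof -
    have "{f. (f, v) \<in> B} \<subseteq> N v" using BE symN E_N by blast
    then show ?thesis using finN finite_subset by blast
  qed
  have lowlev: "c' v + card (E' `` {v}) \<le> j" if v: "v \<in> P \<union> Q" "v \<notin> F" for v
  proof (cases "m v \<le> j")
    case True
    then show ?thesis using m'le[OF v(2)] by linarith
  next
    case False
    then have mv: "m v = Suc j" using mlow[OF v(1)] by simp
    have "\<exists>f. (f, v) \<in> B"
    proof (cases "v \<in> Range T")
      case True then show ?thesis unfolding B_def by auto
    next
      case nT: False
      have "v \<notin> PF" "v \<notin> QF" using v(2) unfolding F_def by auto
      then have "v \<in> Q" "N v \<inter> PF \<noteq> {}" using v(1) mv nT unfolding PF_def QF_def by auto
      then obtain f where "f \<in> PF" "f \<in> N v" by auto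
      then have "(f, v) \<in> B" using symN E_N unfolding B_def by auto
      then show ?thesis ..
    qed
    then have "card {f. (f, v) \<in> B} > 0" using finA[of v] by (auto simp: card_gt_0_iff)
    then show ?thesis using m'le[OF v(2)] mv by linarith
  qed
  have cZ: "c' z = c z" if z: "z \<in> Z" "z \<notin> F" for z
  proof -
    have "B `` {z} = {}"
      using z TW indZ WZ disj unfolding B_def F_def PF_def QF_def by blast
    then show ?thesis unfolding c'_def by simp
  qed
  have "\<exists>D. orients E' D \<and> (\<forall>v \<in> (Q - F) \<union> (P - F) \<union> (Z - F). c' v + card (D `` {v}) \<le> j) \<and>
    (\<forall>(u, v) \<in> E'. c' u + card (D `` {u}) \<noteq> c' v + card (D `` {v}))"
  proof (rule Suc.IH)
    show "finite E'" using finE unfolding E'_def by auto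
    show "finite (Z - F)" using finZ by auto
    show "sym E'" using symE unfolding E'_def sym_def by auto
    show "E' \<subseteq> (Q - F \<union> (P - F) \<union> (Z - F)) \<times> (Q - F \<union> (P - F) \<union> (Z - F))"
      using EV unfolding E'_def by auto
    show "(Q - F) \<inter> (P - F) = {}" "(Q - F) \<inter> (Z - F) = {}" "(P - F) \<inter> (Z - F) = {}" using disj by auto
    show "E' \<inter> (Q - F) \<times> (Q - F) = {}" "E' \<inter> (P - F) \<times> (P - F) = {}" "E' \<inter> (Z - F) \<times> (Z - F) = {}"
      using indP indQ indZ unfolding E'_def by auto
    show "c' v + card (E' `` {v}) \<le> j" if "v \<in> Q - F \<union> (P - F)" for v using lowlev that by auto
  next
    fix z assume z: "z \<in> Z - F"
    let ?a = "card (N z \<inter> P)" and ?b = "card (N z \<inter> Q)"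
    let ?a' = "card (E' `` {z} \<inter> (P - F))" and ?b' = "card (E' `` {z} \<inter> (Q - F))"
    have a': "E' `` {z} \<inter> (P - F) \<subseteq> N z \<inter> P - F" and b': "E' `` {z} \<inter> (Q - F) \<subseteq> N z \<inter> Q - F"
      using E'N by auto
    \<comment> \<open>All of \<open>C z \<inter> P\<close> is in \<open>PF\<close> and disappears
      from the count \<open>?a'\<close>, while \<open>C z \<inter> Q\<close> has at most
      \<open>?b\<close> elements.\<close>
    have s4: "?a' + (Suc j - c z + 1) \<le> ?a + ?b" if "Suc j \<le> c z + ?a + ?b" "c z \<le> Suc j"
    proof -
      have "Suc j - c z + 1 \<le> card (C z)" using Cbig[of z] z that mZ[of z] unfolding F_def by auto
      also have "C z = (C z \<inter> P) \<union> (C z \<inter> Q)" using NZ[of z] z unfolding C_def by auto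
      then have "card (C z) \<le> card (C z \<inter> P) + card (C z \<inter> Q)" by (metis card_Un_le)
      finally have 1: "Suc j - c z + 1 \<le> card (C z \<inter> P) + card (C z \<inter> Q)" .
      have "card (C z \<inter> Q) \<le> ?b" using finN unfolding C_def by (intro card_mono) auto
      moreover have "?a' + card (C z \<inter> P) \<le> ?a"
      proof -
        have "C z \<inter> P \<subseteq> F" unfolding C_def F_def PF_def by auto
        then have "E' `` {z} \<inter> (P - F) \<inter> (C z \<inter> P) = {}" by auto
        moreover have fin: "finite (E' `` {z} \<inter> (P - F))" "finite (C z \<inter> P)"
          using finN[of z] E'N[of z] unfolding C_def by (auto intro: finite_subset)
        ultimately have "?a' + card (C z \<inter> P) = card ((E' `` {z} \<inter> (P - F)) \<union> (C z \<inter> P))"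
          by (simp add: card_Un_disjoint)
        also have "\<dots> \<le> ?a" using finN a' unfolding C_def by (intro card_mono) auto
        finally show ?thesis .
      qed
      ultimately show ?thesis using 1 by linarith
    qed
    have s2: "?a' \<le> ?a" using a' finN by (intro card_mono) auto
    have s3: "?b' \<le> ?b" using b' finN by (intro card_mono) auto
    have s1: "stage_inv K (Suc j) (c z) ?a ?b" using inv[of z] z unfolding N_def by auto
    have "stage_inv K j (c z) ?b' ?a'" by (rule stage_inv_step[OF s1 s2 s3 s4])
    then show "stage_inv K j (c' z) ?b' ?a'" using cZ z by auto
  qed
  then obtain D where D: "orients E' D" and Dle: "\<And>v. v \<in> P \<union> Q \<union> Z \<Longrightarrow> v \<notin> F \<Longrightarrow> c' v + card (D `` {v}) \<le> j"
    and Dne: "\<And>u v. (u, v) \<in> E' \<Longrightarrow> c' u + card (D `` {u}) \<noteq> c' v + card (D `` {v})" by blast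
  have DE': "D \<subseteq> E \<inter> (- F) \<times> (- F)" using D unfolding orients_def E'_def by auto
  have or: "orients E (D \<union> B)"
    by (rule orients_glue[where F = F]) (use symE BE BF tot D in \<open>auto simp: E'_def\<close>)
  have lev: "c v + card ((D \<union> B) `` {v}) = c' v + card (D `` {v})" for v
    using card_Image_glue[OF finE DE' BE BF, of v] unfolding c'_def by simp
  have levF: "c v + card ((D \<union> B) `` {v}) = Suc j" if "v \<in> F" for v
  proof -
    have "D `` {v} = {}" using DE' that by auto
    moreover have "c v + card (B `` {v}) = Suc j"
    proof (cases "v \<in> W")
      case True
      then have "v \<notin> PF" "v \<notin> QF" using WZ disj unfolding PF_def QF_def by auto
      then have "B `` {v} = T `` {v}" using True WZ indZ unfolding B_def by blast
      then show ?thesis using Tcard True by simp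
    next
      case False
      then have v: "v \<in> PF \<union> QF" using that unfolding F_def by auto
      then have "B `` {v} = N v" using BE unfolding B_def N_def by auto
      then show ?thesis using PQF[OF v] unfolding m_def by simp
    qed
    ultimately show ?thesis by (simp add: lev c'_def)
  qed
  show ?case
  proof (intro exI[of _ "D \<union> B"] conjI or ballI)
    fix v assume "v \<in> P \<union> Q \<union> Z"
    then show "c v + card ((D \<union> B) `` {v}) \<le> Suc j"
      using levF[of v] Dle[of v] lev[of v] by (cases "v \<in> F") auto
  next
    fix x assume x: "x \<in> E"
    obtain u v where uv: "x = (u, v)" by (cases x)
    have V: "u \<in> P \<union> Q \<union> Z" "v \<in> P \<union> Q \<union> Z" using x uv EV by auto
    have "\<not> (u \<in> F \<and> v \<in> F)" using x uv indF E_N by auto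
    then consider "u \<in> F" "v \<notin> F" | "v \<in> F" "u \<notin> F" | "u \<notin> F" "v \<notin> F" by blast
    then have "c u + card ((D \<union> B) `` {u}) \<noteq> c v + card ((D \<union> B) `` {v})"
    proof cases
      case 1 then show ?thesis using levF[of u] Dle[OF V(2)] lev[of v] by simp
    next
      case 2 then show ?thesis using levF[of v] Dle[OF V(1)] lev[of u] by simp
    next
      case 3
      then have "(u, v) \<in> E'" using x uv unfolding E'_def by auto
      then show ?thesis using Dne lev by simp
    qed
    then show "case x of (u, v) \<Rightarrow> c u + card ((D \<union> B) `` {u}) \<noteq> c v + card ((D \<union> B) `` {v})"
      using uv by simp
  qed
qed

text \<open>Vertices of \<open>X\<close> and \<open>Y\<close> never exceed \<open>K + 4\<close> and
  \<open>Z\<close> is independent, so \<open>K + 7\<close> is a safe level for any vertex of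
  \<open>Z\<close> that can reach it, with an arbitrary choice of out-arcs. For the other vertices
  of \<open>Z\<close> at most \<open>K + 6\<close> out-arcs are possible, which is where
  \<open>stage_inv\<close> starts.\<close>

lemma active_orientation:
  fixes E :: "'a rel" and c :: "'a \<Rightarrow> nat"
  assumes finE: "finite E" and finZ: "finite Z" and symE: "sym E" and EV: "E \<subseteq> (X \<union> Y \<union> Z) \<times> (X \<union> Y \<union> Z)"
    and disj: "X \<inter> Y = {}" "X \<inter> Z = {}" "Y \<inter> Z = {}"
    and ind: "E \<inter> X \<times> X = {}" "E \<inter> Y \<times> Y = {}" "E \<inter> Z \<times> Z = {}"
    and low: "\<And>v. v \<in> X \<union> Y \<Longrightarrow> c v + card (E `` {v}) \<le> K + 4"
    and cK: "\<And>z. z \<in> Z \<Longrightarrow> c z \<le> K"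
  shows "\<exists>D. orients E D \<and> (\<forall>v \<in> X \<union> Y \<union> Z. c v + card (D `` {v}) \<le> K + 4 \<or>
      v \<in> Z \<and> c v + card (D `` {v}) = K + 7) \<and>
    (\<forall>(u, v) \<in> E. c u + card (D `` {u}) \<noteq> c v + card (D `` {v}))"
proof -
  define N where "N v = E `` {v}" for v
  have finN: "finite (N v)" for v using finE unfolding N_def by (rule finite_Image)
  have E_N: "(v, w) \<in> E \<longleftrightarrow> w \<in> N v" for v w unfolding N_def by auto
  define F where "F = {z \<in> Z. K + 7 \<le> c z + card (N z)}"
  have "\<exists>S. S \<subseteq> N z \<and> card S = K + 7 - c z" if "z \<in> F" for z
  proof -
    have "K + 7 - c z \<le> card (N z)" using that unfolding F_def by auto
    then show ?thesis using obtain_subset_with_card_n by metis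
  qed
  then obtain S where S: "\<And>z. z \<in> F \<Longrightarrow> S z \<subseteq> N z" "\<And>z. z \<in> F \<Longrightarrow> card (S z) = K + 7 - c z" by metis
  have indF: "w \<notin> F" if "v \<in> F" "w \<in> N v" for v w
    using that ind(3) unfolding F_def N_def by auto
  define B where "B = {(z, w). z \<in> F \<and> w \<in> S z} \<union> {(w, z). (w, z) \<in> E \<and> z \<in> F \<and> w \<notin> S z}"
  have BE: "B \<subseteq> E" using S(1) E_N unfolding B_def by auto
  have BF: "u \<in> F \<or> v \<in> F" if "(u, v) \<in> B" for u v using that unfolding B_def by auto
  have key: "(u, v) \<in> B \<longleftrightarrow> (v, u) \<notin> B" if "u \<in> F" "(u, v) \<in> E" "(v, u) \<in> E" for u v
  proof -
    have "v \<notin> F" using indF that E_N by blast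
    then show ?thesis using that unfolding B_def by auto
  qed
  have tot: "(u, v) \<in> B \<longleftrightarrow> (v, u) \<notin> B" if uv: "(u, v) \<in> E" and F: "u \<in> F \<or> v \<in> F" for u v
    using key[of u v] key[of v u] uv symE F by (meson symD)
  define E' where "E' = E \<inter> (- F) \<times> (- F)"
  define c' where "c' v = c v + card (B `` {v})" for v
  have BN: "B `` {v} \<subseteq> N v" for v using BE unfolding N_def by auto
  have E'N: "E' `` {v} \<subseteq> N v" for v unfolding E'_def N_def by auto
  have low': "c' v + card (E' `` {v}) \<le> K + 4" if v: "v \<in> X \<union> Y" for v
  proof -
    have vF: "v \<notin> F" using v disj unfolding F_def by auto
    then have "B `` {v} \<subseteq> F" using BF by blast
    then have "B `` {v} \<inter> E' `` {v} = {}" unfolding E'_def by auto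
    then have "card (B `` {v}) + card (E' `` {v}) = card (B `` {v} \<union> E' `` {v})"
      using finite_subset[OF BN finN] finite_subset[OF E'N finN] by (simp add: card_Un_disjoint)
    also have "\<dots> \<le> card (N v)" using BN E'N finN by (intro card_mono) auto
    finally show ?thesis using low[OF v] unfolding c'_def N_def by simp
  qed
  have cZ: "c' z = c z" if z: "z \<in> Z" "z \<notin> F" for z
  proof -
    have "B `` {z} = {}" using z ind(3) unfolding B_def F_def by blast
    then show ?thesis unfolding c'_def by simp
  qed
  have "\<exists>D. orients E' D \<and> (\<forall>v \<in> X \<union> Y \<union> (Z - F). c' v + card (D `` {v}) \<le> K + 4) \<and>
    (\<forall>(u, v) \<in> E'. c' u + card (D `` {u}) \<noteq> c' v + card (D `` {v}))"
  proof (rule staged_orientation[where K = K])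
    show "finite E'" using finE unfolding E'_def by auto
    show "finite (Z - F)" using finZ by auto
    show "sym E'" using symE unfolding E'_def sym_def by auto
    show "E' \<subseteq> (X \<union> Y \<union> (Z - F)) \<times> (X \<union> Y \<union> (Z - F))" using EV unfolding E'_def by auto
    show "X \<inter> Y = {}" "X \<inter> (Z - F) = {}" "Y \<inter> (Z - F) = {}" using disj by auto
    show "E' \<inter> X \<times> X = {}" "E' \<inter> Y \<times> Y = {}" "E' \<inter> (Z - F) \<times> (Z - F) = {}"
      using ind unfolding E'_def by auto
    show "c' v + card (E' `` {v}) \<le> K + 4" if "v \<in> X \<union> Y" for v using low' that .
  next
    fix z assume z: "z \<in> Z - F"
    have "E' `` {z} \<inter> X \<inter> (E' `` {z} \<inter> Y) = {}" using disj by auto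
    then have "card (E' `` {z} \<inter> X) + card (E' `` {z} \<inter> Y) = card ((E' `` {z} \<inter> X) \<union> (E' `` {z} \<inter> Y))"
      using finite_subset[OF E'N finN] by (simp add: card_Un_disjoint)
    also have "\<dots> \<le> card (N z)" using E'N finN by (intro card_mono) auto
    finally have "c z + card (E' `` {z} \<inter> X) + card (E' `` {z} \<inter> Y) \<le> K + 6"
      using z unfolding F_def by auto
    then show "stage_inv K (K + 4) (c' z) (card (E' `` {z} \<inter> X)) (card (E' `` {z} \<inter> Y))"
      using cZ[of z] cK[of z] z unfolding stage_inv_def by auto
  qed
  then obtain D where D: "orients E' D" and Dle: "\<And>v. v \<in> X \<union> Y \<union> (Z - F) \<Longrightarrow> c' v + card (D `` {v}) \<le> K + 4"
    and Dne: "\<And>u v. (u, v) \<in> E' \<Longrightarrow> c' u + card (D `` {u}) \<noteq> c' v + card (D `` {v})" by blast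
  have DE': "D \<subseteq> E \<inter> (- F) \<times> (- F)" using D unfolding orients_def E'_def by auto
  have or: "orients E (D \<union> B)"
    by (rule orients_glue[where F = F]) (use symE BE BF tot D in \<open>auto simp: E'_def\<close>)
  have lev: "c v + card ((D \<union> B) `` {v}) = c' v + card (D `` {v})" for v
    using card_Image_glue[OF finE DE' BE BF, of v] unfolding c'_def by simp
  have levF: "c v + card ((D \<union> B) `` {v}) = K + 7" if "v \<in> F" for v
  proof -
    have "D `` {v} = {}" using DE' that by auto
    moreover have "B `` {v} = S v"
    proof -
      have "\<not> ((v, z) \<in> E \<and> z \<in> F)" for z using indF that E_N by blast
      then show ?thesis using that unfolding B_def by blast
    qed
    moreover have "c v \<le> K" using cK that unfolding F_def by auto
    ultimately show ?thesis using S(2)[OF that] by (simp add: lev c'_def)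
  qed
  have FZ: "F \<subseteq> Z" unfolding F_def by auto
  show ?thesis
  proof (intro exI[of _ "D \<union> B"] conjI or ballI)
    fix v assume "v \<in> X \<union> Y \<union> Z"
    then show "c v + card ((D \<union> B) `` {v}) \<le> K + 4 \<or> v \<in> Z \<and> c v + card ((D \<union> B) `` {v}) = K + 7"
      using levF[of v] Dle[of v] lev[of v] FZ by (cases "v \<in> F") auto
  next
    fix x assume x: "x \<in> E"
    obtain u v where uv: "x = (u, v)" by (cases x)
    have V: "u \<in> X \<union> Y \<union> Z" "v \<in> X \<union> Y \<union> Z" using x uv EV by auto
    have "\<not> (u \<in> F \<and> v \<in> F)" using x uv indF E_N by auto
    then consider "u \<in> F" "v \<notin> F" | "v \<in> F" "u \<notin> F" | "u \<notin> F" "v \<notin> F" by blast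
    then have "c u + card ((D \<union> B) `` {u}) \<noteq> c v + card ((D \<union> B) `` {v})"
    proof cases
      case 1 then show ?thesis using levF[of u] Dle[of v] V lev[of v] by auto
    next
      case 2 then show ?thesis using levF[of v] Dle[of u] V lev[of u] by auto
    next
      case 3
      then have "(u, v) \<in> E'" using x uv unfolding E'_def by auto
      then show ?thesis using Dne lev by simp
    qed
    then show "case x of (u, v) \<Rightarrow> c u + card ((D \<union> B) `` {u}) \<noteq> c v + card ((D \<union> B) `` {v})"
      using uv by simp
  qed
qed

section \<open>Reversing arcs and optimal orientations\<close>

lemma orientsD:
  assumes "orients E D"
  shows "(u, v) \<in> D \<Longrightarrow> (u, v) \<in> E" "(u, v) \<in> E \<Longrightarrow> (u, v) \<in> D \<or> (v, u) \<in> D" "(u, v) \<in> D \<Longrightarrow> (v, u) \<notin> D"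
    "(u, v) \<in> D \<Longrightarrow> (v, u) \<in> E"
  using assms unfolding orients_def by auto

lemma orientsI:
  assumes "\<And>u v. (u, v) \<in> D \<Longrightarrow> (u, v) \<in> E \<and> (v, u) \<in> E \<and> (v, u) \<notin> D"
    and "\<And>u v. (u, v) \<in> E \<Longrightarrow> (u, v) \<in> D \<or> (v, u) \<in> D"
  shows "orients E D"
  using assms unfolding orients_def by auto

lemma orients_flip:
  assumes or: "orients E D" and T: "T \<subseteq> D"
  shows "orients E ((D - T) \<union> T\<inverse>)"
proof (rule orientsI)
  fix u v assume uv: "(u, v) \<in> (D - T) \<union> T\<inverse>"
  have "(u, v) \<in> T \<Longrightarrow> (u, v) \<in> D" "(v, u) \<in> T \<Longrightarrow> (v, u) \<in> D" using T by auto
  then show "(u, v) \<in> E \<and> (v, u) \<in> E \<and> (v, u) \<notin> (D - T) \<union> T\<inverse>"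
    using uv orientsD[OF or, of u v] orientsD[OF or, of v u] by auto
next
  fix u v assume "(u, v) \<in> E"
  then show "(u, v) \<in> (D - T) \<union> T\<inverse> \<or> (v, u) \<in> (D - T) \<union> T\<inverse>"
    using orientsD(2)[OF or, of u v] by auto
qed

text \<open>Reversing \<open>(v, u)\<close> changes the weighted sum by \<open>wt u - wt v\<close>,
  and only the capacity of \<open>u\<close> can forbid it.\<close>

lemma weighted_optimum:
  fixes E :: "'a rel" and kap wt :: "'a \<Rightarrow> nat"
  assumes finV: "finite V" and EV: "E \<subseteq> V \<times> V"
    and D0: "orients E D0" "\<And>v. v \<in> V \<Longrightarrow> card (D0 `` {v}) \<le> kap v"
  shows "\<exists>D. orients E D \<and> (\<forall>v \<in> V. card (D `` {v}) \<le> kap v) \<and>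
    (\<forall>(v, u) \<in> D. card (D `` {u}) < kap u \<longrightarrow> wt u \<le> wt v)"
proof -
  define \<Phi> where "\<Phi> D = (\<Sum>v\<in>V. wt v * card (D `` {v}))" for D :: "'a rel"
  define ok where "ok D \<longleftrightarrow> orients E D \<and> (\<forall>v \<in> V. card (D `` {v}) \<le> kap v)" for D
  have "ok D0" using D0 unfolding ok_def by auto
  moreover have "\<forall>D. ok D \<longrightarrow> \<Phi> D < Suc (\<Sum>v\<in>V. wt v * kap v)"
    unfolding ok_def \<Phi>_def by (auto intro!: le_imp_less_Suc sum_mono)
  ultimately have "\<exists>x. ok x \<and> (\<forall>y. ok y \<longrightarrow> \<Phi> y \<le> \<Phi> x)" by (rule ex_has_greatest_nat)
  then obtain D where D: "ok D" and max: "\<And>D'. ok D' \<Longrightarrow> \<Phi> D' \<le> \<Phi> D" by blast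
  have orD: "orients E D" using D unfolding ok_def by auto
  have "wt u \<le> wt v" if vu: "(v, u) \<in> D" and lt: "card (D `` {u}) < kap u" for v u
  proof -
    define D' where "D' = (D - {(v, u)}) \<union> {(v, u)}\<inverse>"
    have or: "orients E D'" unfolding D'_def by (rule orients_flip[OF orD]) (use vu in auto)
    have uv: "(u, v) \<notin> D" "u \<noteq> v" using vu orD unfolding orients_def by auto
    have V: "u \<in> V" "v \<in> V" using vu orD EV unfolding orients_def by auto
    have finD: "finite (D `` {w})" for w
    proof (rule finite_subset)
      show "D `` {w} \<subseteq> V" using orD EV unfolding orients_def by auto
    qed fact
    have "D' `` {u} = insert v (D `` {u})" using uv unfolding D'_def by auto
    then have cu: "card (D' `` {u}) = Suc (card (D `` {u}))" using uv finD by auto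
    have "D `` {v} = insert u (D' `` {v})" "u \<notin> D' `` {v}" using vu uv unfolding D'_def by auto
    then have cv: "card (D `` {v}) = Suc (card (D' `` {v}))" using finD[of v] by (metis card_insert_disjoint finite_insert)
    have cw: "D' `` {w} = D `` {w}" if "w \<noteq> u" "w \<noteq> v" for w using that unfolding D'_def by auto
    have D'kap: "card (D' `` {w}) \<le> kap w" if "w \<in> V" for w
    proof -
      have k: "card (D `` {w}) \<le> kap w" using D that unfolding ok_def by blast
      consider "w = u" | "w = v" | "w \<noteq> u" "w \<noteq> v" by blast
      then show ?thesis
      proof cases
        case 1 then show ?thesis using cu lt by simp
      next
        case 2 then show ?thesis using cv k by simp
      next
        case 3 then show ?thesis using cw k by simp
      qed
    qed
    have "ok D'" using or D'kap unfolding ok_def by blast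
    then have le: "\<Phi> D' \<le> \<Phi> D" by (rule max)
    have split: "(\<Sum>w\<in>V. f w) = f u + (f v + (\<Sum>w\<in>V - {u} - {v}. f w))" for f :: "'a \<Rightarrow> nat"
      using sum.remove[of V u f] sum.remove[of "V - {u}" v f] V uv finV by auto
    have "(\<Sum>w\<in>V - {u} - {v}. wt w * card (D' `` {w})) = (\<Sum>w\<in>V - {u} - {v}. wt w * card (D `` {w}))"
      using cw by (intro sum.cong) auto
    then show ?thesis using le unfolding \<Phi>_def split cu cv by simp
  qed
  then show ?thesis using D unfolding ok_def by blast
qed

text \<open>
  In the optimal orientation, vertices of \<open>V2\<close> of degree above \<open>K + 5\<close> have out-degree exactly
  \<open>K + 6\<close>, those of degree \<open>K + 5\<close> (the set \<open>U\<close>) have only out-arcs, and a vertex of \<open>V1\<close> below its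
  capacity receives arcs only from vertices of \<open>V2\<close> of degree at least \<open>K + 5\<close>. Then arcs from \<open>U\<close>
  are reversed to lift a maximal set \<open>S \<subseteq> V1\<close> to \<open>K + 5\<close> or \<open>K + 8\<close>; the rest of \<open>V1\<close> cannot reach
  \<open>K + 5\<close> afterwards.
\<close>

lemma proper_orientation_bound:
  fixes E :: "'a rel"
  assumes finV: "finite V1" "finite V2" "finite V3"
    and disj: "V1 \<inter> V2 = {}" "V1 \<inter> V3 = {}" "V2 \<inter> V3 = {}"
    and symE: "sym E" and EV: "E \<subseteq> (V1 \<union> V2 \<union> V3) \<times> (V1 \<union> V2 \<union> V3)"
    and ind: "E \<inter> V1 \<times> V1 = {}" "E \<inter> V2 \<times> V2 = {}" "E \<inter> V3 \<times> V3 = {}"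
    and D0: "orients E D0"
    and le1: "\<And>v. v \<in> V1 \<Longrightarrow> card (D0 `` {v}) \<le> K + 2"
    and le2: "\<And>v. v \<in> V2 \<Longrightarrow> card (D0 `` {v}) \<le> K + 6"
    and le3: "\<And>v. v \<in> V3 \<Longrightarrow> card (D0 `` {v}) \<le> K"
  shows "\<exists>D. orients E D \<and> (\<forall>v \<in> V1 \<union> V2 \<union> V3. card (D `` {v}) \<le> K + 8) \<and>
    (\<forall>(u, v) \<in> E. card (D `` {u}) \<noteq> card (D `` {v}))"
proof -
  define V where "V = V1 \<union> V2 \<union> V3"
  have fV: "finite V" using finV unfolding V_def by simp
  have EV': "E \<subseteq> V \<times> V" using EV unfolding V_def .
  have finE: "finite E" using finite_subset[OF EV'] fV by simp
  define N where "N v = E `` {v}" for v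
  have finN: "finite (N v)" for v using finE unfolding N_def by (rule finite_Image)
  have symN: "w \<in> N v \<longleftrightarrow> v \<in> N w" for v w using symE unfolding N_def by (auto dest: symD)
  have E_N: "(v, w) \<in> E \<longleftrightarrow> w \<in> N v" for v w unfolding N_def by auto
  have ind1: "w \<notin> V1" if "w \<in> N v" "v \<in> V1" for v w using that ind(1) unfolding N_def by auto
  have ind2: "w \<notin> V2" if "w \<in> N v" "v \<in> V2" for v w using that ind(2) unfolding N_def by auto
  define U where "U = {u \<in> V2. card (N u) = K + 5}"
  define Big where "Big = {u \<in> V2. K + 5 \<le> card (N u)}"
  define q where "q x = card (N x \<inter> U)" for x
  \<comment> \<open>All edges at \<open>U\<close> will point away from \<open>U\<close>. If
    \<open>q x \<le> 3\<close> and \<open>x\<close> is at capacity, reversing all \<open>q x\<close>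
    arcs from \<open>U\<close> lifts \<open>x\<close> to exactly \<open>K + 5\<close>. The threshold
    3 keeps \<open>cap x\<close> at least \<open>K + 2\<close>, the bound that \<open>D0\<close>
    obeys on \<open>V1\<close>; for larger \<open>q x\<close> there are enough arcs to aim at either
    \<open>K + 5\<close> or \<open>K + 8\<close>.\<close>
  define cap where "cap x = (if q x \<le> 3 then K + 5 - q x else K + 5)" for x
  define kap where "kap v = (if v \<in> V1 then cap v else if v \<in> V3 then K else
    if v \<in> Big then K + 6 else card (N v))" for v
  \<comment> \<open>What counts is the order: \<open>Big\<close> above \<open>V1\<close> above the
    rest. As \<open>Big\<close> and \<open>V1\<close> are independent, nothing points into an
    unsaturated vertex of \<open>Big\<close>, and only \<open>Big\<close> points into an unsaturated
    vertex of \<open>V1\<close>.\<close>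
  define wt :: "'a \<Rightarrow> nat" where "wt v = (if v \<in> V1 then 2 else if v \<in> V3 then 0 else
    if v \<in> Big then 4 else 1)" for v
  have UB: "U \<subseteq> Big" and BV: "Big \<subseteq> V2" unfolding U_def Big_def by auto
  have "card (D0 `` {v}) \<le> kap v" if "v \<in> V" for v
  proof -
    have "D0 `` {v} \<subseteq> N v" using orientsD(1)[OF D0] unfolding N_def by auto
    then have "card (D0 `` {v}) \<le> card (N v)" using finN card_mono by blast
    then show ?thesis using le1[of v] le2[of v] le3[of v] that disj unfolding V_def kap_def cap_def by auto
  qed
  then obtain D where or: "orients E D" and Dkap: "\<And>v. v \<in> V \<Longrightarrow> card (D `` {v}) \<le> kap v"
    and Dopt: "\<And>v u. (v, u) \<in> D \<Longrightarrow> card (D `` {u}) < kap u \<Longrightarrow> wt u \<le> wt v"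
    using weighted_optimum[OF fV EV' D0, of kap wt] by blast
  note orD = orientsD[OF or]
  have DN: "D `` {v} \<subseteq> N v" for v using orD(1) unfolding N_def by auto
  have finD: "finite (D `` {v})" for v by (rule finite_subset[OF DN finN])
  have DN2: "u \<in> N v" "v \<in> N u" if "(u, v) \<in> D" for u v using orD(1,4)[OF that] unfolding E_N by auto
  have P1: "card (D `` {u}) = K + 6" if vu: "(v, u) \<in> D" and u: "u \<in> Big" for u v
  proof (rule ccontr)
    assume neq: "card (D `` {u}) \<noteq> K + 6"
    have k: "kap u = K + 6" "wt u = 4" using u BV disj unfolding kap_def wt_def by auto
    have "u \<in> V" using u BV unfolding V_def by auto
    from Dkap[OF this] have "wt u \<le> wt v" using Dopt[OF vu] neq k by auto
    then have "v \<in> Big" using k(2) unfolding wt_def by (auto split: if_splits)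
    then show False using ind2[of v u] DN2[OF vu] u BV by auto
  qed
  have Uout: "D `` {u} = N u" if u: "u \<in> U" for u
  proof -
    have no: "(v, u) \<notin> D" for v
    proof
      assume "(v, u) \<in> D"
      then have "card (D `` {u}) = K + 6" using P1 u UB by blast
      moreover have "card (D `` {u}) \<le> card (N u)" using DN finN card_mono by blast
      ultimately show False using u unfolding U_def by simp
    qed
    show ?thesis using no DN[of u] orD(2)[of u] unfolding N_def by blast
  qed
  have Bout: "card (D `` {u}) = K + 6" if u: "u \<in> Big - U" for u
  proof (cases "\<exists>v. (v, u) \<in> D")
    case True then show ?thesis using P1 u by auto
  next
    case False
    then have "D `` {u} = N u" using DN[of u] orD(2)[of u] unfolding N_def by blast
    then have "K + 6 \<le> card (D `` {u})" using u unfolding Big_def U_def by auto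
    moreover have "u \<in> V" "kap u = K + 6" using u BV disj unfolding V_def kap_def by auto
    ultimately show ?thesis using Dkap[of u] by auto
  qed
  have P2: "v \<in> Big" if "x \<in> V1" "card (D `` {x}) < cap x" "(v, x) \<in> D" for x v
  proof -
    have "wt x \<le> wt v" using Dopt[OF that(3)] that unfolding kap_def by auto
    then have "v \<in> V1 \<or> v \<in> Big" using that unfolding wt_def by (auto split: if_splits)
    then show ?thesis using ind1[of v x] DN2[OF that(3)] that(1) by auto
  qed
  \<comment> \<open>\<open>T\<close> consists of the arcs to be reversed. Level \<open>K + 8\<close>
    clashes with nothing; level \<open>K + 5\<close> would clash with a vertex of \<open>U\<close>
    that keeps all its out-arcs, hence the inclusion in \<open>Domain T\<close>.\<close>
  define valid where "valid = (\<lambda>(S, T). S \<subseteq> V1 \<and> T \<subseteq> E \<inter> U \<times> S \<and>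
     (\<forall>x \<in> S. card (D `` {x}) + card (T\<inverse> `` {x}) = K + 8 \<or>
       card (D `` {x}) + card (T\<inverse> `` {x}) = K + 5 \<and> N x \<inter> U \<subseteq> Domain T))"
  have "valid ({}, {})" unfolding valid_def by auto
  moreover have "\<forall>y. valid y \<longrightarrow> card (fst y) < Suc (card V1)"
    using finV(1) unfolding valid_def by (auto intro!: le_imp_less_Suc card_mono)
  ultimately have "\<exists>x. valid x \<and> (\<forall>y. valid y \<longrightarrow> card (fst y) \<le> card (fst x))"
    by (rule ex_has_greatest_nat)
  then obtain S T where ST: "valid (S, T)"
    and max: "\<And>S' T'. valid (S', T') \<Longrightarrow> card S' \<le> card S" by force
  have SV: "S \<subseteq> V1" and TE: "T \<subseteq> E \<inter> U \<times> S"
    and lvS: "\<And>x. x \<in> S \<Longrightarrow> card (D `` {x}) + card (T\<inverse> `` {x}) = K + 8 \<or>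
       card (D `` {x}) + card (T\<inverse> `` {x}) = K + 5 \<and> N x \<inter> U \<subseteq> Domain T"
    using ST unfolding valid_def by auto
  have finS: "finite S" using SV finV(1) finite_subset by blast
  have noR: "\<not> (card (D `` {x}) + card R = K + 8 \<or>
       card (D `` {x}) + card R = K + 5 \<and> N x \<inter> U \<subseteq> Domain T \<union> R)"
    if x: "x \<in> V1 - S" and R: "R \<subseteq> N x \<inter> U" for x R
  proof
    assume a: "card (D `` {x}) + card R = K + 8 \<or>
       card (D `` {x}) + card R = K + 5 \<and> N x \<inter> U \<subseteq> Domain T \<union> R"
    define T' where "T' = T \<union> R \<times> {x}"
    have dom: "Domain T \<subseteq> Domain T'" "Domain T' = Domain T \<union> R" unfolding T'_def by auto
    have "T\<inverse> `` {x} = {}" using TE x by auto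
    then have im1: "T'\<inverse> `` {x} = R" unfolding T'_def by auto
    have im2: "T'\<inverse> `` {w} = T\<inverse> `` {w}" if "w \<noteq> x" for w using that unfolding T'_def by auto
    have v1: "insert x S \<subseteq> V1" using x SV by auto
    have "R \<times> {x} \<subseteq> E" using R E_N symN by auto
    then have v2: "T' \<subseteq> E \<inter> U \<times> insert x S" using TE R unfolding T'_def by auto
    have v3: "card (D `` {w}) + card (T'\<inverse> `` {w}) = K + 8 \<or>
       card (D `` {w}) + card (T'\<inverse> `` {w}) = K + 5 \<and> N w \<inter> U \<subseteq> Domain T'" if w: "w \<in> insert x S" for w
    proof (cases "w = x")
      case True then show ?thesis using a im1 dom(2) by simp
    next
      case False
      then have "w \<in> S" using w by simp
      from lvS[OF this] show ?thesis unfolding im2[OF False] using dom(1) by blast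
    qed
    have "valid (insert x S, T')" unfolding valid_def prod.case
      by (intro conjI ballI v1 v2 v3)
    then have "card (insert x S) \<le> card S" by (rule max)
    then show False using x finS by simp
  qed
  have act: "card (D `` {x}) < cap x" "card (D `` {x}) + card (N x \<inter> U \<inter> Domain T) \<le> K + 4"
    if x: "x \<in> V1 - S" for x
  proof -
    define out where "out = card (D `` {x})"
    define s where "s = card (N x \<inter> U \<inter> Domain T)"
    have fin: "finite (N x \<inter> U)" using finN by simp
    have sq: "s \<le> q x" unfolding s_def q_def using fin by (intro card_mono) auto
    have "x \<in> V" "kap x = cap x" using x unfolding V_def kap_def by auto
    then have oc: "out \<le> cap x" using Dkap[of x] unfolding out_def by auto
    have "out < cap x \<and> out + s \<le> K + 4"
    proof (cases "q x \<le> 3")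
      case True
      have "out \<noteq> cap x"
      proof
        assume "out = cap x"
        then have "out + q x = K + 5" using True unfolding cap_def by simp
        then show False using noR[OF x order_refl] unfolding out_def q_def by auto
      qed
      then show ?thesis using oc True sq unfolding cap_def by auto
    next
      case False
      then have cx: "cap x = K + 5" unfolding cap_def by simp
      have "out + q x \<le> K + 7"
      proof (rule ccontr)
        assume "\<not> ?thesis"
        then have "K + 8 - out \<le> card (N x \<inter> U)" unfolding q_def by simp
        then obtain R where R: "R \<subseteq> N x \<inter> U" "card R = K + 8 - out"
          using obtain_subset_with_card_n by metis
        have "card (D `` {x}) + card R = K + 8" using R(2) oc cx unfolding out_def by simp
        then show False using noR[OF x R(1)] by blast
      qed
      moreover have "out + s \<le> K + 4"
      proof (rule ccontr)
        assume as: "\<not> ?thesis"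
        \<comment> \<open>From \<open>out + s \<ge> K + 5\<close> and
          \<open>out + q x \<le> K + 7\<close>, at most two neighbours in \<open>U\<close> are
          outside \<open>Domain T\<close>; and \<open>q x \<ge> 4\<close> gives
          \<open>K + 5 - out \<ge> 2\<close>. So a set of \<open>K + 5 - out\<close> neighbours in
          \<open>U\<close> can include them all.\<close>
        have "card (N x \<inter> U - Domain T) + s = q x"
          unfolding s_def q_def using fin by (metis card_Int_Diff add.commute)
        then have "card (N x \<inter> U - Domain T) \<le> K + 5 - out" "K + 5 - out \<le> card (N x \<inter> U)"
          using as calculation False sq unfolding q_def[symmetric] by linarith+
        then obtain R where R: "N x \<inter> U - Domain T \<subseteq> R" "R \<subseteq> N x \<inter> U" "card R = K + 5 - out"
          using exists_subset_between[OF _ _ Diff_subset fin] by metis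
        have "card (D `` {x}) + card R = K + 5" using R(3) oc cx unfolding out_def by simp
        then show False using noR[OF x R(2)] R(1) by blast
      qed
      ultimately show ?thesis using False cx by auto
    qed
    then show "card (D `` {x}) < cap x" "card (D `` {x}) + card (N x \<inter> U \<inter> Domain T) \<le> K + 4"
      unfolding out_def s_def by auto
  qed
  have TD: "T \<subseteq> D" using TE Uout unfolding N_def by blast
  define D1 where "D1 = (D - T) \<union> T\<inverse>"
  have or1: "orients E D1" unfolding D1_def by (rule orients_flip[OF or TD])
  note or1D = orientsD[OF or1]
  have D1N: "D1 `` {v} \<subseteq> N v" for v using or1D(1) unfolding N_def by auto
  have D1same: "D1 `` {v} = D `` {v}" if "v \<notin> S" "v \<notin> Domain T" for v
    using that TE unfolding D1_def by auto
  have D1S: "card (D1 `` {x}) = card (D `` {x}) + card (T\<inverse> `` {x})" if x: "x \<in> S" for x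
  proof -
    have "x \<notin> U" using x SV UB BV disj by auto
    then have "D1 `` {x} = D `` {x} \<union> T\<inverse> `` {x}" using TE unfolding D1_def by auto
    moreover have "D `` {x} \<inter> T\<inverse> `` {x} = {}" using TD orD(3) by auto
    moreover have "finite (T\<inverse> `` {x})" using TD DN2 by (intro finite_subset[OF _ finN[of x]]) auto
    ultimately show ?thesis using finD by (simp add: card_Un_disjoint)
  qed
  define Dm where "Dm = Domain T"
  have DmU: "Dm \<subseteq> U" using TE unfolding Dm_def by auto
  define Fz where "Fz = S \<union> (Big - Dm)"
  define B where "B = {(u, v) \<in> D1. u \<in> Fz \<or> v \<in> Fz}"
  define E' where "E' = E \<inter> (- Fz) \<times> (- Fz)"
  define X Y where "X = V1 - S" and "Y = (V2 - Big) \<union> Dm"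
  have V2: "Dm \<subseteq> V2" "U \<subseteq> V2" using DmU UB BV by auto
  have XF: "X \<inter> Fz = {}" "Y \<inter> Fz = {}" "V3 \<inter> Fz = {}"
    using disj SV V2 BV unfolding X_def Y_def Fz_def by blast+
  have BN: "B `` {v} \<subseteq> N v" for v using D1N unfolding B_def by auto
  have E'N: "E' `` {v} \<subseteq> N v" for v unfolding E'_def N_def by auto
  have fB: "finite (B `` {v})" "finite (E' `` {v})" for v
    using finite_subset[OF BN finN] finite_subset[OF E'N finN] by auto
  have BE': "B `` {v} \<inter> E' `` {v} = {}" if "v \<notin> Fz" for v using that unfolding B_def E'_def by auto
  have sumBE: "card (B `` {v}) + card (E' `` {v}) = card (B `` {v} \<union> E' `` {v})" if "v \<notin> Fz" for v
    using fB BE'[OF that] by (simp add: card_Un_disjoint)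
  have lowX: "card (B `` {x}) + card (E' `` {x}) \<le> K + 4" if x: "x \<in> X" for x
  proof -
    have x': "x \<in> V1 - S" using x unfolding X_def .
    have xT: "x \<notin> Domain T" using x' V2 disj unfolding Dm_def by auto
    have same: "D1 `` {x} = D `` {x}" using D1same x' xT by auto
    have "B `` {x} \<subseteq> D `` {x}" using same unfolding B_def by auto
    \<comment> \<open>By \<open>P2\<close>, an edge at \<open>x\<close> that is not an out-arc comes
      from \<open>Big\<close>. Unless its other end is in \<open>Dm\<close>, that end is fixed and
      the edge is already an in-arc of \<open>x\<close>.\<close>
    moreover have "E' `` {x} \<subseteq> D `` {x} \<union> (N x \<inter> U \<inter> Domain T)"
    proof
      fix w assume w: "w \<in> E' `` {x}"
      then have xw: "(x, w) \<in> E" "w \<notin> Fz" unfolding E'_def by auto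
      show "w \<in> D `` {x} \<union> (N x \<inter> U \<inter> Domain T)"
      proof (cases "(x, w) \<in> D")
        case False
        then have "(w, x) \<in> D" using orD(2) xw by blast
        then have "w \<in> Big" using P2 act(1)[OF x'] x' by blast
        then have "w \<in> Dm" using xw unfolding Fz_def by auto
        then show ?thesis using DmU xw unfolding Dm_def N_def by auto
      qed auto
    qed
    ultimately have "B `` {x} \<union> E' `` {x} \<subseteq> D `` {x} \<union> (N x \<inter> U \<inter> Domain T)" by blast
    then have "card (B `` {x} \<union> E' `` {x}) \<le> card (D `` {x} \<union> (N x \<inter> U \<inter> Domain T))"
      using finD finN by (intro card_mono) auto
    also have "\<dots> \<le> card (D `` {x}) + card (N x \<inter> U \<inter> Domain T)" by (rule card_Un_le)
    finally have "card (B `` {x} \<union> E' `` {x}) \<le> K + 4" using act(2)[OF x'] by linarith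
    moreover have "x \<notin> Fz" using XF x by auto
    ultimately show ?thesis using sumBE by simp
  qed
  have lowY: "card (B `` {y}) + card (E' `` {y}) \<le> K + 4" if y: "y \<in> Y" for y
  proof -
    have yF: "y \<notin> Fz" using XF y by auto
    show ?thesis
    proof (cases "y \<in> Dm")
      \<comment> \<open>Such a \<open>y\<close> has degree \<open>K + 5\<close>, and one of its
        edges has been reversed into an in-arc from a fixed vertex.\<close>
      case True
      then obtain x where yx: "(y, x) \<in> T" unfolding Dm_def by auto
      have "x \<in> Fz" using yx TE unfolding Fz_def by auto
      moreover have "(x, y) \<in> D1" using yx unfolding D1_def by auto
      then have "(y, x) \<notin> D1" using or1D(3) by blast
      ultimately have "B `` {y} \<union> E' `` {y} \<subseteq> N y - {x}" using BN[of y] E'N[of y]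
        unfolding B_def E'_def by auto
      then have "card (B `` {y} \<union> E' `` {y}) \<le> card (N y - {x})" using finN by (intro card_mono) auto
      moreover have "x \<in> N y" using yx TE E_N by auto
      moreover have "card (N y) = K + 5" using True DmU unfolding U_def by auto
      ultimately show ?thesis using sumBE[OF yF] finN by simp
    next
      case False
      then have "y \<in> V2 - Big" using y unfolding Y_def by auto
      then have "card (N y) \<le> K + 4" unfolding Big_def by auto
      moreover have "card (B `` {y} \<union> E' `` {y}) \<le> card (N y)" using BN E'N finN by (intro card_mono) auto
      ultimately show ?thesis using sumBE[OF yF] by simp
    qed
  qed
  have lowZ: "card (B `` {z}) \<le> K" if z: "z \<in> V3" for z
  proof -
    have "z \<notin> S" "z \<notin> Domain T" using z disj SV V2 unfolding Dm_def by auto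
    then have "B `` {z} \<subseteq> D `` {z}" using D1same unfolding B_def by auto
    then have "card (B `` {z}) \<le> card (D `` {z})" using finD card_mono by blast
    moreover have "z \<in> V" "kap z = K" using z disj unfolding V_def kap_def by auto
    ultimately show ?thesis using Dkap[of z] by simp
  qed
  have "\<exists>D. orients E' D \<and> (\<forall>v \<in> X \<union> Y \<union> V3. card (B `` {v}) + card (D `` {v}) \<le> K + 4 \<or>
      v \<in> V3 \<and> card (B `` {v}) + card (D `` {v}) = K + 7) \<and>
    (\<forall>(u, v) \<in> E'. card (B `` {u}) + card (D `` {u}) \<noteq> card (B `` {v}) + card (D `` {v}))"
  proof (rule active_orientation)
    show "finite E'" using finE unfolding E'_def by auto
    show "finite V3" by fact
    show "sym E'" using symE unfolding E'_def sym_def by auto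
    have "V1 \<union> V2 \<union> V3 \<subseteq> Fz \<union> (X \<union> Y \<union> V3)" unfolding Fz_def X_def Y_def by auto
    then show "E' \<subseteq> (X \<union> Y \<union> V3) \<times> (X \<union> Y \<union> V3)" using EV unfolding E'_def by auto
    show "X \<inter> Y = {}" "X \<inter> V3 = {}" "Y \<inter> V3 = {}" using disj V2 unfolding X_def Y_def by auto
    show "E' \<inter> X \<times> X = {}" "E' \<inter> Y \<times> Y = {}" "E' \<inter> V3 \<times> V3 = {}"
      using ind V2 unfolding E'_def X_def Y_def by blast+
    show "card (B `` {v}) + card (E' `` {v}) \<le> K + 4" if "v \<in> X \<union> Y" for v using lowX lowY that by auto
    show "card (B `` {z}) \<le> K" if "z \<in> V3" for z using lowZ that .
  qed
  then obtain D2 where or2: "orients E' D2"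
    and D2le: "\<And>v. v \<in> X \<union> Y \<union> V3 \<Longrightarrow> card (B `` {v}) + card (D2 `` {v}) \<le> K + 4 \<or>
      card (B `` {v}) + card (D2 `` {v}) = K + 7"
    and D2ne: "\<And>u v. (u, v) \<in> E' \<Longrightarrow> card (B `` {u}) + card (D2 `` {u}) \<noteq> card (B `` {v}) + card (D2 `` {v})"
    by blast
  have D2E: "D2 \<subseteq> E \<inter> (- Fz) \<times> (- Fz)" using orientsD(1)[OF or2] unfolding E'_def by auto
  have BE: "B \<subseteq> E" using or1D(1) unfolding B_def by auto
  have BF: "u \<in> Fz \<or> v \<in> Fz" if "(u, v) \<in> B" for u v using that unfolding B_def by auto
  have tot: "(u, v) \<in> B \<longleftrightarrow> (v, u) \<notin> B" if "(u, v) \<in> E" "u \<in> Fz \<or> v \<in> Fz" for u v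
    using that or1D(2)[of u v] or1D(3)[of u v] unfolding B_def by auto
  have orF: "orients E (D2 \<union> B)"
    by (rule orients_glue[where F = Fz]) (use symE BE BF tot or2 in \<open>auto simp: E'_def\<close>)
  have lev: "card ((D2 \<union> B) `` {v}) = card (B `` {v}) + card (D2 `` {v})" for v
    using card_Image_glue[OF finE D2E BE BF, of v] by simp
  have levF: "card ((D2 \<union> B) `` {v}) = card (D1 `` {v})" if v: "v \<in> Fz" for v
  proof -
    have "D2 `` {v} = {}" using D2E v by auto
    moreover have "B `` {v} = D1 `` {v}" using v unfolding B_def by auto
    ultimately show ?thesis using lev by simp
  qed
  have levS: "card ((D2 \<union> B) `` {x}) = K + 8 \<or> card ((D2 \<union> B) `` {x}) = K + 5 \<and> N x \<inter> U \<subseteq> Dm"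
    if x: "x \<in> S" for x
    using lvS[OF x] levF[of x] D1S[OF x] x unfolding Fz_def Dm_def by auto
  have levB: "card ((D2 \<union> B) `` {u}) = (if u \<in> U then K + 5 else K + 6)" if u: "u \<in> Big - Dm" for u
  proof -
    have "u \<notin> S" using u SV BV disj by auto
    then have "card ((D2 \<union> B) `` {u}) = card (D `` {u})"
      using levF[of u] D1same[of u] u unfolding Fz_def Dm_def by auto
    then show ?thesis using Bout[of u] Uout[of u] u unfolding U_def by auto
  qed
  have levA: "card ((D2 \<union> B) `` {v}) \<le> K + 4 \<or> card ((D2 \<union> B) `` {v}) = K + 7" if "v \<in> V - Fz" for v
  proof -
    have "v \<in> X \<union> Y \<union> V3" using that unfolding V_def Fz_def X_def Y_def by auto
    then show ?thesis using D2le lev by simp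
  qed
  have levF': "card ((D2 \<union> B) `` {v}) \<in> {K + 5, K + 6, K + 8}" if "v \<in> Fz" for v
    using that levS[of v] levB[of v] unfolding Fz_def by (auto split: if_splits)
  have mixed: "card ((D2 \<union> B) `` {u}) \<noteq> card ((D2 \<union> B) `` {v})" if "u \<in> Fz" "v \<in> V - Fz" for u v
    using levF'[OF that(1)] levA[OF that(2)] by auto
  have SB: "card ((D2 \<union> B) `` {x}) \<noteq> card ((D2 \<union> B) `` {u})"
    if "x \<in> S" "u \<in> Big - Dm" "u \<in> N x" for x u
    using levS[OF that(1)] levB[OF that(2)] that(2,3) by (auto split: if_splits)
  have main: "card ((D2 \<union> B) `` {u}) \<noteq> card ((D2 \<union> B) `` {v})" if uv: "(u, v) \<in> E" for u v
  proof -
    have uV: "u \<in> V" "v \<in> V" using uv EV' by auto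
    have n: "v \<in> N u" "u \<in> N v" using uv E_N symN by auto
    consider "u \<in> Fz" "v \<notin> Fz" | "v \<in> Fz" "u \<notin> Fz" | "u \<notin> Fz" "v \<notin> Fz" | "u \<in> Fz" "v \<in> Fz" by blast
    then show ?thesis
    proof cases
      case 1 then show ?thesis using mixed[of u v] uV by auto
    next
      case 2 then show ?thesis using mixed[of v u] uV by auto
    next
      case 3
      then have "(u, v) \<in> E'" using uv unfolding E'_def by auto
      then show ?thesis using D2ne lev by simp
    next
      case 4
      have "\<not> (u \<in> S \<and> v \<in> S)" using ind1 n SV by blast
      moreover have "\<not> (u \<in> Big \<and> v \<in> Big)" using ind2 n BV by blast
      ultimately have "u \<in> S \<and> v \<in> Big - Dm \<or> v \<in> S \<and> u \<in> Big - Dm" using 4 unfolding Fz_def by blast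
      then show ?thesis using SB[of u v] SB[of v u] n by auto
    qed
  qed
  have bound: "card ((D2 \<union> B) `` {v}) \<le> K + 8" if "v \<in> V" for v
    using levF'[of v] levA[of v] that by (cases "v \<in> Fz") auto
  show ?thesis using orF main bound unfolding V_def by (intro exI[of _ "D2 \<union> B"]) auto
qed

subsection \<open>Hakimi's theorem\<close>

text \<open>Stop the path at its first visit to \<open>x\<close>. This makes the path survive the
  reversal of an arc that leaves \<open>x\<close>.\<close>

lemma relpow_avoid_arc:
  assumes "(v, x) \<in> D ^^ n"
  shows "\<exists>k \<le> n. (v, x) \<in> (D - {(x, w)}) ^^ k"
  using assms
proof (induction n arbitrary: v)
  case 0
  then show ?case by (intro exI[of _ 0]) simp
next
  case (Suc n)
  from Suc.prems obtain y where y: "(v, y) \<in> D" "(y, x) \<in> D ^^ n" by (meson relpow_Suc_D2)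
  from Suc.IH[OF y(2)] obtain k where k: "k \<le> n" "(y, x) \<in> (D - {(x, w)}) ^^ k" by blast
  show ?case
  proof (cases "v = x")
    case True
    then show ?thesis by (intro exI[of _ 0]) simp
  next
    case False
    then have "(v, y) \<in> D - {(x, w)}" using y(1) by auto
    then have "(v, x) \<in> (D - {(x, w)}) ^^ Suc k" using k(2) by (meson relpow_Suc_I2)
    then show ?thesis using k(1) by (meson Suc_le_mono)
  qed
qed

lemma relpow_mono:
  fixes R S :: "'a rel"
  assumes "R \<subseteq> S"
  shows "R ^^ n \<subseteq> S ^^ n"
  using assms by (induction n) (auto intro: relcomp_mono)

text \<open>
  If an orientation of minimal total excess has a vertex with excess, flipping
  the last arc of a shortest path to a vertex with slack gives a shorter such path or less excess;
  hence the vertices reachable from it have no slack.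
\<close>

lemma orientation_outdegree_le:
  fixes E :: "'a rel" and m :: "'a \<Rightarrow> nat"
  assumes finV: "finite V" and EV: "E \<subseteq> V \<times> V" and D0: "orients E D0"
    and hall: "\<And>D X. orients E D \<Longrightarrow> X \<subseteq> V \<Longrightarrow> card (D \<inter> X \<times> X) \<le> (\<Sum>v\<in>X. m v)"
  shows "\<exists>D. orients E D \<and> (\<forall>v \<in> V. card (D `` {v}) \<le> m v)"
proof -
  define \<Phi> where "\<Phi> D = (\<Sum>v\<in>V. card (D `` {v}) - m v)" for D :: "'a rel"
  define best where "best D \<longleftrightarrow> orients E D \<and> (\<forall>D'. orients E D' \<longrightarrow> \<Phi> D \<le> \<Phi> D')" for D
  have finD: "finite (D `` {v})" if "orients E D" for D v
  proof (rule finite_subset)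
    show "D `` {v} \<subseteq> V" using orientsD(1)[OF that] EV by auto
  qed fact
  have no_path: "False" if "best D" "(v, w) \<in> D ^^ n" "v \<in> V" "m v < card (D `` {v})" "w \<in> V" "card (D `` {w}) < m w"
    for n D v w
    using that
  proof (induction n arbitrary: D w rule: less_induct)
    case (less n)
    show False
    proof (cases n)
      case 0
      then show False using less.prems by simp
    next
      case (Suc k)
      then obtain x where x: "(v, x) \<in> D ^^ k" "(x, w) \<in> D" using less.prems(2) by auto
      have or: "orients E D" using less.prems(1) unfolding best_def by blast
      define D' where "D' = (D - {(x, w)}) \<union> {(x, w)}\<inverse>"
      have or': "orients E D'" unfolding D'_def by (rule orients_flip[OF or]) (use x in auto)
      have wx: "(w, x) \<notin> D" "w \<noteq> x" using x(2) orientsD(3)[OF or] by blast+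
      have xV: "x \<in> V" using x(2) orientsD(1)[OF or] EV by blast
      have "D' `` {w} = insert x (D `` {w})" using wx unfolding D'_def by auto
      then have cw: "card (D' `` {w}) = Suc (card (D `` {w}))" using wx finD[OF or] by auto
      have "D `` {x} = insert w (D' `` {x})" "w \<notin> D' `` {x}" using x(2) wx unfolding D'_def by auto
      then have cx: "card (D `` {x}) = Suc (card (D' `` {x}))"
        using finD[OF or, of x] by (metis card_insert_disjoint finite_insert)
      have co: "D' `` {y} = D `` {y}" if "y \<noteq> w" "y \<noteq> x" for y using that unfolding D'_def by auto
      have split: "(\<Sum>y\<in>V. f y) = f w + (f x + (\<Sum>y\<in>V - {w} - {x}. f y))" for f :: "'a \<Rightarrow> nat"
        using sum.remove[of V w f] sum.remove[of "V - {w}" x f] xV less.prems(5) wx finV by auto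
      have "(\<Sum>y\<in>V - {w} - {x}. card (D' `` {y}) - m y) = (\<Sum>y\<in>V - {w} - {x}. card (D `` {y}) - m y)"
        using co by (intro sum.cong) auto
      then have \<Phi>': "\<Phi> D' + (card (D `` {x}) - m x) = \<Phi> D + (card (D' `` {x}) - m x)"
        using less.prems(6) unfolding \<Phi>_def split cw by simp
      have "\<Phi> D \<le> \<Phi> D'" using less.prems(1) or' unfolding best_def by blast
      \<comment> \<open>If \<open>x\<close> had excess, the reversal would lower the total excess.
        So \<open>x\<close> has none, and after the reversal it has slack, at a smaller distance
        from \<open>v\<close>.\<close>
      then have xle: "card (D `` {x}) \<le> m x" and eq: "\<Phi> D' = \<Phi> D" using \<Phi>' cx by auto
      have best': "best D'" using less.prems(1) or' eq unfolding best_def by simp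
      have vw: "v \<noteq> w" "v \<noteq> x" using less.prems(4,6) xle by auto
      obtain k' where k': "k' \<le> k" "(v, x) \<in> (D - {(x, w)}) ^^ k'" using relpow_avoid_arc[OF x(1)] by blast
      have "(v, x) \<in> D' ^^ k'"
        using k'(2) relpow_mono[of "D - {(x, w)}" D' k'] unfolding D'_def by blast
      then show False
        using less.IH[of k' D' x] k'(1) Suc best' less.prems(3,4) co[OF vw] xV xle cx by auto
    qed
  qed
  obtain D where D: "best D"
  proof -
    have "\<exists>D. orients E D \<and> (\<forall>D'. orients E D' \<longrightarrow> \<Phi> D \<le> \<Phi> D')"
      using D0 by (rule ex_has_least_nat)
    then show ?thesis using that unfolding best_def by blast
  qed
  have or: "orients E D" using D unfolding best_def by blast
  have "card (D `` {v}) \<le> m v" if v: "v \<in> V" for v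
  proof (rule ccontr)
    assume "\<not> ?thesis"
    then have over: "m v < card (D `` {v})" by simp
    define X where "X = D\<^sup>* `` {v}"
    have XV: "X \<subseteq> V"
    proof
      fix x assume "x \<in> X"
      then have "(v, x) \<in> D\<^sup>*" unfolding X_def by simp
      then show "x \<in> V" by (induction rule: rtrancl_induct) (use v EV orientsD(1)[OF or] in auto)
    qed
    have ge: "m x \<le> card (D `` {x})" if x: "x \<in> X" for x
    proof (rule ccontr)
      assume "\<not> ?thesis"
      moreover obtain n where "(v, x) \<in> D ^^ n" using x rtrancl_imp_relpow unfolding X_def by fast
      ultimately show False using no_path[OF D, of v x n] v over x XV by auto
    qed
    have finX: "finite X" using XV finV finite_subset by blast
    \<comment> \<open>No arc leaves the reachable set \<open>X\<close>, so the arcs inside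
      \<open>X\<close> are counted by the out-degrees of its vertices; these sum to more than
      \<open>hall\<close> allows.\<close>
    have "D \<inter> X \<times> X = Sigma X (\<lambda>x. D `` {x})"
      unfolding X_def by (auto intro: rtrancl_into_rtrancl)
    then have "card (D \<inter> X \<times> X) = (\<Sum>x\<in>X. card (D `` {x}))"
      using finX finD[OF or] by simp
    also have "\<dots> > (\<Sum>x\<in>X. m x)"
    proof (rule sum_strict_mono_ex1)
      show "\<forall>x\<in>X. m x \<le> card (D `` {x})" using ge by blast
      show "\<exists>x\<in>X. m x < card (D `` {x})" using over unfolding X_def by blast
    qed fact
    finally show False using hall[OF or XV] by simp
  qed
  then show ?thesis using or by blast
qed

section \<open>From edge bounds to a proper orientation\<close>

lemma proper_orientation_of_sparse:
  fixes E :: "'a rel"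
  assumes finV: "finite V1" "finite V2" "finite V3"
    and disj: "V1 \<inter> V2 = {}" "V1 \<inter> V3 = {}" "V2 \<inter> V3 = {}"
    and symE: "sym E" and EV: "E \<subseteq> (V1 \<union> V2 \<union> V3) \<times> (V1 \<union> V2 \<union> V3)"
    and ind: "E \<inter> V1 \<times> V1 = {}" "E \<inter> V2 \<times> V2 = {}" "E \<inter> V3 \<times> V3 = {}"
    and sparse: "\<And>X1 X2 X3. X1 \<subseteq> V1 \<Longrightarrow> X2 \<subseteq> V2 \<Longrightarrow> X3 \<subseteq> V3 \<Longrightarrow>
      card (E \<inter> (X1 \<union> X2) \<times> X3) + card (E \<inter> X2 \<times> X1) \<le> (K + 2) * card X1 + 4 * card X2 + K * card X3"
  shows "\<exists>D. orients E D \<and> (\<forall>v \<in> V1 \<union> V2 \<union> V3. card (D `` {v}) \<le> K + 8) \<and>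
    (\<forall>(u, v) \<in> E. card (D `` {u}) \<noteq> card (D `` {v}))"
proof -
  define m where "m v = (if v \<in> V1 then K + 2 else if v \<in> V2 then 4 else K)" for v
  define Up where "Up = E \<inter> ((V1 \<union> V2) \<times> V3 \<union> V2 \<times> V1)"
  have sy: "(u, v) \<in> E \<Longrightarrow> (v, u) \<in> E" for u v using symE by (meson symD)
  have D0: "orients E Up"
  proof (rule orientsI)
    fix u v assume "(u, v) \<in> Up"
    then show "(u, v) \<in> E \<and> (v, u) \<in> E \<and> (v, u) \<notin> Up" using sy disj unfolding Up_def by auto
  next
    fix u v assume uv: "(u, v) \<in> E"
    then have "u \<in> V1 \<union> V2 \<union> V3" "v \<in> V1 \<union> V2 \<union> V3" using EV by auto
    then show "(u, v) \<in> Up \<or> (v, u) \<in> Up" using uv ind sy[OF uv] unfolding Up_def by auto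
  qed
  have "\<exists>D. orients E D \<and> (\<forall>v \<in> V1 \<union> V2 \<union> V3. card (D `` {v}) \<le> m v)"
  proof (rule orientation_outdegree_le[OF _ EV D0])
    show "finite (V1 \<union> V2 \<union> V3)" using finV by simp
  next
    fix D X assume or: "orients E D" and X: "X \<subseteq> V1 \<union> V2 \<union> V3"
    define X1 X2 X3 where "X1 = X \<inter> V1" and "X2 = X \<inter> V2" and "X3 = X \<inter> V3"
    have fX: "finite X1" "finite X2" "finite X3" using finV unfolding X1_def X2_def X3_def by auto
    \<comment> \<open>\<open>f\<close> turns each arc of \<open>D\<close> into the direction in
      which \<open>sparse\<close> counts its edge; it is injective because \<open>D\<close> has no
      opposite arcs.\<close>
    define f where "f = (\<lambda>(u, v). if (u, v) \<in> Up then (u, v) else (v, u))"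
    have "inj_on f D"
    proof (rule inj_onI)
      fix a b assume "a \<in> D" "b \<in> D" "f a = f b"
      then show "a = b" using orientsD(3)[OF or] unfolding f_def by (auto split: if_splits prod.splits)
    qed
    then have "inj_on f (D \<inter> X \<times> X)" by (rule inj_on_subset) auto
    moreover have "f ` (D \<inter> X \<times> X) \<subseteq> (E \<inter> (X1 \<union> X2) \<times> X3) \<union> (E \<inter> X2 \<times> X1)"
    proof
      fix a assume "a \<in> f ` (D \<inter> X \<times> X)"
      then obtain u v where uv: "(u, v) \<in> D" "u \<in> X" "v \<in> X" "a = f (u, v)" by auto
      have "(u, v) \<in> E" using uv(1) orientsD(1)[OF or] by blast
      then have "a \<in> Up" using orientsD(2)[OF D0] uv(4) unfolding f_def by auto
      moreover have "fst a \<in> X" "snd a \<in> X" using uv unfolding f_def by auto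
      ultimately show "a \<in> (E \<inter> (X1 \<union> X2) \<times> X3) \<union> (E \<inter> X2 \<times> X1)"
        unfolding Up_def X1_def X2_def X3_def by auto
    qed
    moreover have "finite (E \<inter> (X1 \<union> X2) \<times> X3)" "finite (E \<inter> X2 \<times> X1)" using fX by auto
    ultimately have "card (D \<inter> X \<times> X) \<le> card ((E \<inter> (X1 \<union> X2) \<times> X3) \<union> (E \<inter> X2 \<times> X1))"
      by (metis card_image card_mono finite_Un)
    also have "\<dots> \<le> card (E \<inter> (X1 \<union> X2) \<times> X3) + card (E \<inter> X2 \<times> X1)" by (rule card_Un_le)
    also have "\<dots> \<le> (K + 2) * card X1 + 4 * card X2 + K * card X3"
      by (rule sparse) (auto simp: X1_def X2_def X3_def)
    also have "\<dots> = (\<Sum>v\<in>X1. m v) + (\<Sum>v\<in>X2. m v) + (\<Sum>v\<in>X3. m v)"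
    proof -
      have a1: "m v = K + 2" if "v \<in> X1" for v using that unfolding m_def X1_def by simp
      have a2: "m v = 4" if "v \<in> X2" for v using that disj unfolding m_def X2_def by auto
      have a3: "m v = K" if "v \<in> X3" for v using that disj unfolding m_def X3_def by auto
      have "sum m X1 = (\<Sum>v\<in>X1. K + 2)" "sum m X2 = (\<Sum>v\<in>X2. 4)" "sum m X3 = (\<Sum>v\<in>X3. K)"
        by (rule sum.cong[OF refl a1] sum.cong[OF refl a2] sum.cong[OF refl a3], assumption)+
      then show ?thesis by simp
    qed
    also have "\<dots> = (\<Sum>v\<in>X. m v)"
    proof -
      have "X = X1 \<union> X2 \<union> X3" using X unfolding X1_def X2_def X3_def by auto
      moreover have "X1 \<inter> X2 = {}" "(X1 \<union> X2) \<inter> X3 = {}" using disj unfolding X1_def X2_def X3_def by auto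
      ultimately show ?thesis using fX by (simp add: sum.union_disjoint)
    qed
    finally show "card (D \<inter> X \<times> X) \<le> (\<Sum>v\<in>X. m v)" .
  qed
  then obtain D where or: "orients E D" and le: "\<And>v. v \<in> V1 \<union> V2 \<union> V3 \<Longrightarrow> card (D `` {v}) \<le> m v" by blast
  show ?thesis
  proof (rule proper_orientation_bound[OF finV disj symE EV ind or])
    show "card (D `` {v}) \<le> K + 2" if "v \<in> V1" for v using le[of v] that unfolding m_def by simp
    show "card (D `` {v}) \<le> K + 6" if "v \<in> V2" for v using le[of v] that disj unfolding m_def by (auto split: if_splits)
    show "card (D `` {v}) \<le> K" if "v \<in> V3" for v using le[of v] that disj unfolding m_def by (auto split: if_splits)
  qed
qed

subsection \<open>Arcs in the plane\<close>

text \<open>An open set inside an arc would embed into the line, against invariance of dimension.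
  Hence every face has points off any given arc.\<close>

lemma interior_arc_image_empty:
  fixes g :: "real \<Rightarrow> complex"
  assumes "arc g" "open U" "U \<subseteq> path_image g"
  shows "U = {}"
proof (rule ccontr)
  assume "U \<noteq> {}"
  obtain h where h: "homeomorphism {0..1} (path_image g) g h"
    using homeomorphism_arc[OF assms(1)] by blast
  then have "continuous_on (path_image g) h" "inj_on h (path_image g)"
    unfolding homeomorphism_def by (auto intro: inj_on_inverseI[of _ g])
  then have "continuous_on U h" "inj_on h U"
    using assms(3) continuous_on_subset inj_on_subset by blast+
  then have "DIM(complex) \<le> DIM(real)"
    using invariance_of_dimension[of U h] \<open>U \<noteq> {}\<close> assms(2) by simp
  then show False by simp
qed

lemma connected_subset_singleton: "A \<subseteq> {x} \<Longrightarrow> connected A"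
  by (metis connected_empty connected_sing subset_singletonD)

lemma loop_of_arcs:
  fixes g h :: "real \<Rightarrow> complex"
  assumes g: "arc g" and h: "arc h" "pathstart h = pathstart g" "pathfinish h = pathfinish g"
    and gh: "path_image g \<inter> path_image h \<subseteq> {pathstart g, pathfinish g}"
  obtains c where "simple_path c" "pathfinish c = pathstart c" "path_image c = path_image g \<union> path_image h"
proof
  let ?c = "g +++ reversepath h"
  show "simple_path ?c"
    by (rule simple_path_join_loop) (use assms in \<open>auto simp: arc_reversepath\<close>)
  show "pathfinish ?c = pathstart ?c" "path_image ?c = path_image g \<union> path_image h"
    using assms by (simp_all add: path_image_join)
qed

lemma path_component_arc:
  fixes S :: "complex set"
  assumes "path_component S x y" "x \<noteq> y"
  obtains h where "arc h" "path_image h \<subseteq> S" "pathstart h = x" "pathfinish h = y"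
  using assms path_contains_arc unfolding path_component_def by (metis subset_trans)

text \<open>
  If \<open>\<Union>\<A>\<close> joins the ends of \<open>g\<close>, then \<open>P\<close> is the inside of the closed curve formed with \<open>g\<close>.
  Otherwise \<open>\<Union>\<A>\<close> falls into two closed parts that meet \<open>g\<close> in at most one point each.
\<close>

lemma arc_sides:
  fixes \<A> :: "complex set set" and g :: "real \<Rightarrow> complex"
  assumes fin: "finite \<A>" and comp: "\<And>A. A \<in> \<A> \<Longrightarrow> compact A \<and> path_connected A"
    and g: "arc g" and gK: "path_image g \<inter> \<Union>\<A> \<subseteq> {pathstart g, pathfinish g}"
  obtains P where "\<And>a b. connected_component (- \<Union>\<A>) a b \<Longrightarrow> a \<notin> path_image g \<Longrightarrow> b \<notin> path_image g \<Longrightarrow>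
    P a \<longleftrightarrow> P b \<Longrightarrow> connected_component (- (\<Union>\<A> \<union> path_image g)) a b"
proof -
  define s t where "s = pathstart g" and "t = pathfinish g"
  have st: "s \<noteq> t" using g unfolding s_def t_def by (metis arc_distinct_ends)
  have cpK: "compact (\<Union>\<A>)" using fin comp by (auto intro: compact_Union)
  have cpg: "compact (path_image g)" using g by (simp add: compact_arc_image)
  have cg: "connected (- path_image g)" using g by (rule connected_arc_complement) simp
  show ?thesis
  proof (cases "path_component (\<Union>\<A>) s t")
    case True
    then obtain h where h: "arc h" "path_image h \<subseteq> \<Union>\<A>" "pathstart h = s" "pathfinish h = t"
      using path_component_arc st by metis
    have "path_image g \<inter> path_image h \<subseteq> {pathstart g, pathfinish g}" using gK h(2) by blast
    then obtain c where c: "simple_path c" "pathfinish c = pathstart c"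
      and ci: "path_image c = path_image g \<union> path_image h"
      using loop_of_arcs[OF g h(1)] h(3,4) unfolding s_def t_def by blast
    note J = Jordan_inside_outside[OF c(1,2)]
    have "s \<in> path_image h" "t \<in> path_image h" using h(3,4) by auto
    \<comment> \<open>The closed curve meets \<open>\<Union>\<A>\<close> exactly in the arc
      \<open>h\<close>, and this connected intersection is what Janiszewski's theorem needs.\<close>
    then have ST: "path_image c \<inter> \<Union>\<A> = path_image h"
      using gK h(2) unfolding ci s_def t_def by blast
    have un: "path_image c \<union> \<Union>\<A> = \<Union>\<A> \<union> path_image g" using h(2) unfolding ci by blast
    show ?thesis
    proof (rule that[of "\<lambda>a. a \<in> inside (path_image c)"])
      fix a b
      assume ab: "connected_component (- \<Union>\<A>) a b" "a \<notin> path_image g" "b \<notin> path_image g"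
        and eq: "a \<in> inside (path_image c) \<longleftrightarrow> b \<in> inside (path_image c)"
      have "a \<notin> \<Union>\<A>" "b \<notin> \<Union>\<A>" using ab(1) connected_component_in by blast+
      then have nc: "a \<notin> path_image c" "b \<notin> path_image c" using ab h(2) unfolding ci by blast+
      have "connected_component (- path_image c) a b"
      proof (cases "a \<in> inside (path_image c)")
        case True
        then show ?thesis using J eq by (intro connected_componentI[of "inside (path_image c)"]) blast+
      next
        case False
        then have "a \<in> outside (path_image c)" "b \<in> outside (path_image c)" using eq J nc by blast+
        then show ?thesis using J by (intro connected_componentI[of "outside (path_image c)"]) blast+
      qed
      moreover have "connected (path_image c \<inter> \<Union>\<A>)" unfolding ST using h(1) by (simp add: connected_arc_image)
      ultimately have "connected_component (- (path_image c \<union> \<Union>\<A>)) a b"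
        using ab(1) c(1) cpK by (intro Janiszewski) (auto simp: compact_imp_closed compact_simple_path_image)
      then show "connected_component (- (\<Union>\<A> \<union> path_image g)) a b" unfolding un .
    qed
  next
    case False
    define \<B> where "\<B> = {A \<in> \<A>. \<exists>x\<in>A. path_component (\<Union>\<A>) s x}"
    have near: "path_component (\<Union>\<A>) s x" if A: "A \<in> \<B>" and x: "x \<in> A" for A x
    proof -
      obtain y where y: "y \<in> A" "path_component (\<Union>\<A>) s y" "A \<in> \<A>" using A unfolding \<B>_def by blast
      have "path_component A y x" using comp[OF y(3)] y(1) x by (simp add: path_connected_component)
      then have "path_component (\<Union>\<A>) y x" using y(3) path_component_of_subset by (metis Union_upper)
      then show ?thesis using y(2) path_component_trans by blast
    qed
    have far: "\<not> path_component (\<Union>\<A>) s x" if "A \<in> \<A> - \<B>" "x \<in> A" for A x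
      using that unfolding \<B>_def by blast
    have split: "\<Union>\<A> = \<Union>\<B> \<union> \<Union>(\<A> - \<B>)" unfolding \<B>_def by blast
    have B: "\<Union>\<B> \<inter> \<Union>(\<A> - \<B>) = {}" using near far by blast
    have cp: "compact (\<Union>\<B>)" "compact (\<Union>(\<A> - \<B>))"
      using fin comp unfolding \<B>_def by (auto intro!: compact_Union)
    have sB: "path_image g \<inter> \<Union>\<B> \<subseteq> {s}"
    proof -
      have "t \<notin> \<Union>\<B>" using near False by blast
      then show ?thesis using gK split unfolding s_def t_def by blast
    qed
    have tB: "\<Union>(\<A> - \<B>) \<inter> (path_image g \<union> \<Union>\<B>) \<subseteq> {t}"
    proof -
      have "s \<notin> \<Union>(\<A> - \<B>)"
      proof
        assume "s \<in> \<Union>(\<A> - \<B>)"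
        then obtain A where A: "A \<in> \<A> - \<B>" "s \<in> A" by blast
        then have "path_component (\<Union>\<A>) s s" by (intro path_component_refl) blast
        then show False using far A by blast
      qed
      then show ?thesis using gK split B unfolding s_def t_def by blast
    qed
    show ?thesis
    proof (rule that[of "\<lambda>_. True"])
      fix a b
      assume ab: "connected_component (- \<Union>\<A>) a b" "a \<notin> path_image g" "b \<notin> path_image g"
      have 1: "connected_component (- path_image g) a b"
        using cg ab by (intro connected_componentI[of "- path_image g"]) auto
      have 2: "connected_component (- \<Union>\<B>) a b" "connected_component (- \<Union>(\<A> - \<B>)) a b"
        using connected_component_of_subset[OF ab(1)] split by blast+
      have 3: "connected_component (- (path_image g \<union> \<Union>\<B>)) a b"
        by (rule Janiszewski[OF cpg compact_imp_closed[OF cp(1)] connected_subset_singleton[OF sB] 1 2(1)])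
      have "connected_component (- (\<Union>(\<A> - \<B>) \<union> (path_image g \<union> \<Union>\<B>))) a b"
        by (rule Janiszewski[OF cp(2) _ connected_subset_singleton[OF tB] 2(2) 3])
          (use cpg cp in \<open>auto intro: compact_imp_closed\<close>)
      moreover have "\<Union>(\<A> - \<B>) \<union> (path_image g \<union> \<Union>\<B>) = \<Union>\<A> \<union> path_image g" using split by blast
      ultimately show "connected_component (- (\<Union>\<A> \<union> path_image g)) a b" by simp
    qed
  qed
qed

text \<open>The arc and a path in \<open>K\<close> between its ends form a Jordan curve. Both sides
  of the curve accumulate at \<open>x\<close>, so the open set \<open>C\<close> contains points of
  each.\<close>

lemma arc_separates:
  fixes K :: "complex set" and g :: "real \<Rightarrow> complex"
  assumes K: "compact K" and g: "arc g" and gK: "path_image g \<inter> K \<subseteq> {pathstart g, pathfinish g}"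
    and conn: "path_component K (pathstart g) (pathfinish g)"
    and C: "C \<in> components (- K)" and x: "x \<in> C" "x \<in> path_image g"
  obtains a b where "a \<in> C" "b \<in> C" "a \<notin> path_image g" "b \<notin> path_image g"
    "\<not> connected_component (- (K \<union> path_image g)) a b"
proof -
  have "pathstart g \<noteq> pathfinish g" using g by (metis arc_distinct_ends)
  then obtain h where h: "arc h" "path_image h \<subseteq> K" "pathstart h = pathstart g" "pathfinish h = pathfinish g"
    using path_component_arc conn by metis
  have "path_image g \<inter> path_image h \<subseteq> {pathstart g, pathfinish g}" using gK h(2) by blast
  then obtain c where c: "simple_path c" "pathfinish c = pathstart c"
    and ci: "path_image c = path_image g \<union> path_image h"
    using loop_of_arcs[OF g h(1)] h(3,4) by blast
  note J = Jordan_inside_outside[OF c(1,2)]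
  have oC: "open C" using C K open_components[of "- K" C] by (simp add: compact_imp_closed open_Compl)
  have "x \<in> frontier (inside (path_image c))" "x \<in> frontier (outside (path_image c))"
    using J x(2) ci by auto
  then have "C \<inter> inside (path_image c) \<noteq> {}" "C \<inter> outside (path_image c) \<noteq> {}"
    using oC x(1) open_Int_closure_eq_empty unfolding frontier_def by blast+
  then obtain a b where ab: "a \<in> C" "a \<in> inside (path_image c)" "b \<in> C" "b \<in> outside (path_image c)" by blast
  show ?thesis
  proof
    show "a \<in> C" "b \<in> C" by fact+
    show "a \<notin> path_image g" "b \<notin> path_image g" using ab J unfolding ci by blast+
    show "\<not> connected_component (- (K \<union> path_image g)) a b"
    proof
      assume "connected_component (- (K \<union> path_image g)) a b"
      then obtain T where T: "connected T" "T \<subseteq> - (K \<union> path_image g)" "a \<in> T" "b \<in> T"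
        unfolding connected_component_def by blast
      have "T \<subseteq> - path_image c" using T(2) h(2) unfolding ci by blast
      then have "T \<subseteq> inside (path_image c) \<union> outside (path_image c)" using J by blast
      then show False using connectedD[OF T(1), of "inside (path_image c)" "outside (path_image c)"] J T(3,4) ab by blast
    qed
  qed
qed

text \<open>Serves to avoid the vertices, which may lie on the frontier of a face without belonging
  to an edge on its boundary.\<close>

lemma connected_component_minus_finite:
  fixes X :: "complex set"
  assumes "open X" "connected_component X a b" "finite Q" "a \<notin> Q" "b \<notin> Q"
  shows "connected_component (X - Q) a b"
proof (rule connected_componentI)
  let ?C = "connected_component_set X a"
  show "connected (?C - Q)"
    by (rule connected_open_delete_finite) (use assms in \<open>auto simp: open_connected_component\<close>)
  show "?C - Q \<subseteq> X - Q" using connected_component_subset by blast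
  show "a \<in> ?C - Q" "b \<in> ?C - Q"
    using assms connected_component_in by (auto simp: connected_component_refl_eq)
qed

subsection \<open>Faces of a drawing\<close>

locale arc_drawing =
  fixes V :: "'a set" and p :: "'a \<Rightarrow> complex" and E :: "'a set set" and \<gamma> :: "'a set \<Rightarrow> real \<Rightarrow> complex"
  assumes finite_V: "finite V" and inj_p: "inj_on p V"
    and edge_subset: "e \<in> E \<Longrightarrow> e \<subseteq> V"
    and arc_edge: "e \<in> E \<Longrightarrow> arc (\<gamma> e)"
    and ends: "e \<in> E \<Longrightarrow> {pathstart (\<gamma> e), pathfinish (\<gamma> e)} = p ` e"
    and on_V: "e \<in> E \<Longrightarrow> path_image (\<gamma> e) \<inter> p ` V = p ` e"
    and meet: "e \<in> E \<Longrightarrow> f \<in> E \<Longrightarrow> e \<noteq> f \<Longrightarrow> path_image (\<gamma> e) \<inter> path_image (\<gamma> f) \<subseteq> p ` (e \<inter> f)"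
begin

text \<open>
  Isolated vertices do not belong to \<open>K S\<close>.
\<close>

definition K :: "'a set set \<Rightarrow> complex set" where
  "K S = (\<Union>e\<in>S. path_image (\<gamma> e))"

definition body :: "'a set \<Rightarrow> complex set" where
  "body e = path_image (\<gamma> e) - p ` V"

definition faces :: "'a set set \<Rightarrow> complex set set" where
  "faces S = components (- K S)"

text \<open>Touching a face in an end does not count: any number of faces may meet at a vertex,
  while inner points of an edge border at most two.\<close>

definition bd :: "'a set set \<Rightarrow> complex set \<Rightarrow> 'a set set" where
  "bd S f = {e \<in> S. frontier f \<inter> body e \<noteq> {}}"

lemma finite_E: "finite E"
  using finite_V edge_subset by (intro finite_subset[of E "Pow V"]) auto

lemma K_insert: "K (insert e S) = K S \<union> path_image (\<gamma> e)"
  unfolding K_def by auto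

lemma K_mono: "S \<subseteq> T \<Longrightarrow> K S \<subseteq> K T"
  unfolding K_def by auto

lemma compact_K:
  assumes "S \<subseteq> E"
  shows "compact (K S)"
  unfolding K_def
  using assms finite_subset[OF assms finite_E] arc_edge by (intro compact_UN) (auto simp: compact_arc_image)

lemma closed_K: "S \<subseteq> E \<Longrightarrow> closed (K S)"
  using compact_K compact_imp_closed by blast

lemma body_eq: "e \<in> E \<Longrightarrow> body e = path_image (\<gamma> e) - {pathstart (\<gamma> e), pathfinish (\<gamma> e)}"
  using on_V[of e] ends[of e] unfolding body_def by blast

lemma connected_body: "e \<in> E \<Longrightarrow> connected (body e)"
  using body_eq arc_edge connected_simple_path_endless arc_imp_simple_path by metis

lemma closure_body:
  assumes e: "e \<in> E"
  shows "path_image (\<gamma> e) \<subseteq> closure (body e)"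
proof -
  have c: "continuous_on {0..1} (\<gamma> e)" and inj: "inj_on (\<gamma> e) {0..1}"
    using arc_edge[OF e] unfolding arc_def path_def by auto
  have sub: "\<gamma> e ` {0<..<1} \<subseteq> body e"
  proof
    fix x assume "x \<in> \<gamma> e ` {0<..<1}"
    then obtain t where t: "0 < t" "t < 1" "x = \<gamma> e t" by auto
    have "x \<noteq> \<gamma> e 0" "x \<noteq> \<gamma> e 1" using t inj_onD[OF inj, of t 0] inj_onD[OF inj, of t 1] by auto
    then show "x \<in> body e"
      using t unfolding body_eq[OF e] pathstart_def pathfinish_def path_image_def by auto
  qed
  have "\<gamma> e ` closure {0<..<1} \<subseteq> closure (\<gamma> e ` {0<..<1})"
    by (rule image_closure_subset) (use c in \<open>simp_all add: closure_subset\<close>)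
  then have "\<gamma> e ` {0..1} \<subseteq> closure (\<gamma> e ` {0<..<1})" by simp
  then show ?thesis using closure_mono[OF sub] unfolding path_image_def by (rule order_trans)
qed

lemma body_nonempty: "e \<in> E \<Longrightarrow> body e \<noteq> {}"
  using closure_body pathstart_in_path_image by fastforce

lemma image_Int_K:
  assumes "e \<in> E" "S \<subseteq> E" "e \<notin> S"
  shows "path_image (\<gamma> e) \<inter> K S \<subseteq> p ` (e \<inter> \<Union>S)"
proof
  fix x assume "x \<in> path_image (\<gamma> e) \<inter> K S"
  then obtain f where f: "f \<in> S" "x \<in> path_image (\<gamma> e) \<inter> path_image (\<gamma> f)" unfolding K_def by auto
  then have "x \<in> p ` (e \<inter> f)" using meet[of e f] assms by blast
  then show "x \<in> p ` (e \<inter> \<Union>S)" using f(1) by auto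
qed

lemma image_Int_K_ends:
  assumes "e \<in> E" "S \<subseteq> E" "e \<notin> S"
  shows "path_image (\<gamma> e) \<inter> K S \<subseteq> {pathstart (\<gamma> e), pathfinish (\<gamma> e)}"
  using image_Int_K[OF assms] ends[OF assms(1)] by blast

lemma body_Int_K: "e \<in> E \<Longrightarrow> S \<subseteq> E \<Longrightarrow> e \<notin> S \<Longrightarrow> body e \<inter> K S = {}"
  using image_Int_K_ends[of e S] body_eq[of e] by blast

lemma body_subset_K: "e \<in> S \<Longrightarrow> body e \<subseteq> K S"
  unfolding body_def K_def by auto

lemma sides:
  assumes "S \<subseteq> E" "e \<in> E" "e \<notin> S"
  obtains P where "\<And>a b. connected_component (- K S) a b \<Longrightarrow> a \<notin> path_image (\<gamma> e) \<Longrightarrow>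
    b \<notin> path_image (\<gamma> e) \<Longrightarrow> P a \<longleftrightarrow> P b \<Longrightarrow> connected_component (- K (insert e S)) a b"
proof -
  let ?A = "(\<lambda>e. path_image (\<gamma> e)) ` S"
  have K: "\<Union>?A = K S" unfolding K_def ..
  have "finite ?A" using assms(1) finite_E finite_subset by blast
  moreover have "compact A \<and> path_connected A" if A: "A \<in> ?A" for A
  proof -
    obtain f where "f \<in> E" "A = path_image (\<gamma> f)" using A assms(1) by auto
    then show ?thesis using arc_edge[of f] by (auto simp: compact_arc_image arc_imp_path path_connected_path_image)
  qed
  moreover have "path_image (\<gamma> e) \<inter> \<Union>?A \<subseteq> {pathstart (\<gamma> e), pathfinish (\<gamma> e)}"
    unfolding K using image_Int_K_ends assms by blast
  ultimately obtain P where "\<And>a b. connected_component (- \<Union>?A) a b \<Longrightarrow> a \<notin> path_image (\<gamma> e) \<Longrightarrow>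
    b \<notin> path_image (\<gamma> e) \<Longrightarrow> P a \<longleftrightarrow> P b \<Longrightarrow> connected_component (- (\<Union>?A \<union> path_image (\<gamma> e))) a b"
    using arc_sides[of ?A "\<gamma> e"] arc_edge[OF assms(2)] by blast
  then show ?thesis using that unfolding K K_insert by blast
qed

lemma face_open: "S \<subseteq> E \<Longrightarrow> f \<in> faces S \<Longrightarrow> open f"
  unfolding faces_def using open_components closed_K open_Compl by blast

lemma face_subset: "f \<in> faces S \<Longrightarrow> f \<subseteq> - K S"
  unfolding faces_def using in_components_subset by blast

lemma face_conn:
  assumes "f \<in> faces S" "a \<in> f" "connected_component (- K S) a b"
  shows "b \<in> f"
proof -
  obtain T where T: "connected T" "T \<subseteq> - K S" "a \<in> T" "b \<in> T"
    using assms(3) unfolding connected_component_def by blast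
  then show ?thesis using components_maximal[of f "- K S" T] assms(1,2) unfolding faces_def by blast
qed

lemma face_conn': "f \<in> faces S \<Longrightarrow> a \<in> f \<Longrightarrow> b \<in> f \<Longrightarrow> connected_component (- K S) a b"
  using face_subset unfolding faces_def
  by (intro connected_componentI[of f]) (auto dest: in_components_connected)

lemma face_eq: "f \<in> faces S \<Longrightarrow> g \<in> faces S \<Longrightarrow> a \<in> f \<Longrightarrow> a \<in> g \<Longrightarrow> f = g"
  unfolding faces_def using components_eq by blast

lemma face_of: "a \<notin> K S \<Longrightarrow> \<exists>f \<in> faces S. a \<in> f"
  unfolding faces_def by (metis ComplI UnionE Union_components)

lemma connected_in_face:
  assumes "connected T" "T \<inter> K S = {}" "a \<in> T"
  shows "\<exists>f \<in> faces S. T \<subseteq> f"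
proof -
  obtain f where "f \<in> faces S" "a \<in> f" using face_of[of a S] assms by blast
  then show ?thesis using components_maximal[of f "- K S" T] assms unfolding faces_def by blast
qed

text \<open>Without \<open>e\<close>, its inner points lie in a single face \<open>C\<close>, and
  every face bordered by \<open>e\<close> has points in \<open>C\<close>. Points of \<open>C\<close>
  off the arc with the same label under \<open>P\<close> stay connected when \<open>e\<close>
  returns, so the two-valued label is injective on these faces.\<close>

lemma edge_two_faces:
  assumes S: "S \<subseteq> E" and e: "e \<in> S"
  shows "finite {f \<in> faces S. e \<in> bd S f}" "card {f \<in> faces S. e \<in> bd S f} \<le> 2"
proof -
  let ?F = "{f \<in> faces S. e \<in> bd S f}"
  have eE: "e \<in> E" and S0: "S - {e} \<subseteq> E" "e \<notin> S - {e}" "insert e (S - {e}) = S" using assms by auto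
  obtain P where P: "\<And>a b. connected_component (- K (S - {e})) a b \<Longrightarrow> a \<notin> path_image (\<gamma> e) \<Longrightarrow>
    b \<notin> path_image (\<gamma> e) \<Longrightarrow> P a \<longleftrightarrow> P b \<Longrightarrow> connected_component (- K S) a b"
    using sides[OF S0(1) eE S0(2)] unfolding S0(3) by blast
  obtain C where C: "C \<in> faces (S - {e})" "body e \<subseteq> C"
    using connected_in_face[OF connected_body[OF eE]] body_Int_K[OF eE S0(1,2)] body_nonempty[OF eE] by blast
  have "\<exists>a. a \<in> f \<and> a \<in> C" if f: "f \<in> ?F" for f
  proof -
    obtain x where "x \<in> frontier f" "x \<in> C" using f C(2) unfolding bd_def by blast
    then show ?thesis using face_open[OF S0(1) C(1)] open_Int_closure_eq_empty[of C f] unfolding frontier_def by blast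
  qed
  then obtain a where a: "\<And>f. f \<in> ?F \<Longrightarrow> a f \<in> f \<and> a f \<in> C" by metis
  have "inj_on (\<lambda>f. P (a f)) ?F"
  proof (rule inj_onI)
    fix f g assume f: "f \<in> ?F" and g: "g \<in> ?F" and eq: "P (a f) = P (a g)"
    have "a f \<notin> path_image (\<gamma> e)" "a g \<notin> path_image (\<gamma> e)"
      using a[OF f] a[OF g] f g face_subset e unfolding K_def by blast+
    moreover have "connected_component (- K (S - {e})) (a f) (a g)" using face_conn'[OF C(1)] a f g by blast
    ultimately have "connected_component (- K S) (a f) (a g)" using P eq by blast
    then have "a g \<in> f" using face_conn a[OF f] f by blast
    then show "f = g" using face_eq a[OF g] f g by blast
  qed
  then show "finite ?F" "card ?F \<le> 2"
    using inj_on_finite[of "\<lambda>f. P (a f)" ?F UNIV] card_inj_on_le[of "\<lambda>f. P (a f)" ?F UNIV] by auto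
qed

section \<open>A face and its boundary edges\<close>

lemma face_frontier:
  assumes "S \<subseteq> E" "f \<in> faces S"
  shows "frontier f \<subseteq> K (bd S f) \<union> p ` V"
proof
  fix x assume x: "x \<in> frontier f"
  have "frontier f \<subseteq> K S"
    using assms frontier_of_components_closed_complement[OF closed_K] unfolding faces_def by blast
  then obtain e where "e \<in> S" "x \<in> path_image (\<gamma> e)" using x unfolding K_def by blast
  then show "x \<in> K (bd S f) \<union> p ` V" using x unfolding K_def bd_def body_def by auto
qed

text \<open>A connected set that leaves \<open>f\<close> meets its frontier, which apart from
  vertices lies on edges of \<open>bd S f\<close>. So the other edges may be deleted without
  enlarging \<open>f\<close>, up to vertices.\<close>

lemma face_spread:
  assumes S: "S \<subseteq> E" "f \<in> faces S" and D: "bd S f \<subseteq> D" "D \<subseteq> E"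
    and ab: "connected_component (- K D) a b" "a \<in> f" "a \<notin> p ` V" "b \<notin> p ` V"
  shows "b \<in> f"
proof (rule ccontr)
  assume b: "b \<notin> f"
  have "connected_component (- K D - p ` V) a b"
    using ab finite_V closed_K[OF D(2)] by (intro connected_component_minus_finite) (auto simp: open_Compl)
  then obtain T where T: "connected T" "T \<subseteq> - K D - p ` V" "a \<in> T" "b \<in> T"
    unfolding connected_component_def by blast
  have "T \<inter> frontier f \<noteq> {}" using connected_Int_frontier[OF T(1), of f] T(3,4) ab(2) b by blast
  then show False using face_frontier[OF S] K_mono[OF D(1)] T(2) by blast
qed

lemma face_point:
  assumes "S \<subseteq> E" "f \<in> faces S"
  obtains a where "a \<in> f" "a \<notin> p ` V"
proof -
  have "f \<noteq> {}" using assms(2) in_components_nonempty unfolding faces_def by blast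
  then have "infinite f" using face_open[OF assms] finite_imp_not_open by blast
  then have "\<not> f \<subseteq> p ` V" using finite_V finite_subset by blast
  then show ?thesis using that by blast
qed

text \<open>If the boundary edges do not separate the plane, \<open>face_spread\<close> would put
  inner points of any other edge of \<open>S\<close> into \<open>f\<close>.\<close>

lemma bd_eq_if_connected:
  assumes S: "S \<subseteq> E" "f \<in> faces S" and conn: "connected (- K (bd S f))"
  shows "bd S f = S"
proof -
  have "e \<in> bd S f" if e: "e \<in> S" for e
  proof (rule ccontr)
    assume ne: "e \<notin> bd S f"
    have bE: "bd S f \<subseteq> E" "bd S f \<subseteq> S" using S unfolding bd_def by auto
    obtain a where a: "a \<in> f" "a \<notin> p ` V" using face_point[OF S] .
    obtain b where b: "b \<in> body e" using body_nonempty e S by blast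
    have "b \<notin> K (bd S f)" using body_Int_K[of e "bd S f"] bE e S ne b by blast
    moreover have "a \<notin> K (bd S f)" using a face_subset[OF S(2)] K_mono[OF bE(2)] by blast
    ultimately have "connected_component (- K (bd S f)) a b"
      using conn by (intro connected_componentI[of "- K (bd S f)"]) auto
    then have "b \<in> f" using face_spread[OF S order_refl bE(1)] a b unfolding body_def by blast
    then show False using b e body_subset_K face_subset[OF S(2)] by blast
  qed
  then show ?thesis unfolding bd_def by blast
qed

text \<open>For nonempty \<open>S\<close> every face has a boundary edge, and each edge borders
  finitely many faces.\<close>

lemma finite_faces:
  assumes S: "S \<subseteq> E"
  shows "finite (faces S)"
proof (cases "S = {}")
  case True
  then have "- K S = UNIV" unfolding K_def by simp
  then have "faces S = {UNIV}" unfolding faces_def using connected_UNIV components_eq_sing_iff by (metis UNIV_not_empty)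
  then show ?thesis by simp
next
  case False
  have "bd S f \<noteq> {}" if f: "f \<in> faces S" for f
  proof
    assume "bd S f = {}"
    then have "connected (- K (bd S f))" unfolding K_def by (simp add: connected_UNIV)
    then have "bd S f = S" using bd_eq_if_connected S f by blast
    then show False using False \<open>bd S f = {}\<close> by simp
  qed
  then have "faces S \<subseteq> (\<Union>e\<in>S. {f \<in> faces S. e \<in> bd S f})" unfolding bd_def by blast
  moreover have "finite (\<Union>e\<in>S. {f \<in> faces S. e \<in> bd S f})"
    by (rule finite_UN_I[OF finite_subset[OF S finite_E] edge_two_faces(1)[OF S]])
  ultimately show ?thesis by (rule finite_subset)
qed

section \<open>Euler's inequality\<close>

text \<open>Sending each new face to the old face around it is surjective, because an arc cannot
  cover an open set. It is not injective if the arc closes a cycle, because then two points of one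
  old face are separated.\<close>

lemma faces_insert:
  assumes S: "S \<subseteq> E" and e: "e \<in> E" "e \<notin> S"
  shows "card (faces S) \<le> card (faces (insert e S))"
    "path_component (K S) (pathstart (\<gamma> e)) (pathfinish (\<gamma> e)) \<Longrightarrow> card (faces S) < card (faces (insert e S))"
proof -
  have S': "insert e S \<subseteq> E" using S e by simp
  have "\<exists>f \<in> faces S. g \<subseteq> f" if g: "g \<in> faces (insert e S)" for g
  proof -
    have "connected g" "g \<noteq> {}" using g unfolding faces_def by (auto dest: in_components_connected in_components_nonempty)
    then show ?thesis using connected_in_face[of g S] face_subset[OF g] unfolding K_insert by blast
  qed
  then obtain \<pi> where \<pi>: "\<And>g. g \<in> faces (insert e S) \<Longrightarrow> \<pi> g \<in> faces S \<and> g \<subseteq> \<pi> g" by metis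
  have fin: "finite (faces (insert e S))" by (rule finite_faces[OF S'])
  have \<pi>_eq: "\<pi> g = f" if "g \<in> faces (insert e S)" "f \<in> faces S" "a \<in> g" "a \<in> f" for f g a
    using \<pi>[OF that(1)] that face_eq by blast
  have in_new: "\<exists>g \<in> faces (insert e S). a \<in> g" if "f \<in> faces S" "a \<in> f" "a \<notin> path_image (\<gamma> e)" for f a
    using face_of[of a "insert e S"] that face_subset[OF that(1)] unfolding K_insert by blast
  have surj: "\<pi> ` faces (insert e S) = faces S"
  proof
    show "\<pi> ` faces (insert e S) \<subseteq> faces S" using \<pi> by blast
    show "faces S \<subseteq> \<pi> ` faces (insert e S)"
    proof
      fix f assume f: "f \<in> faces S"
      have "f \<noteq> {}" using f in_components_nonempty unfolding faces_def by blast
      then obtain a where a: "a \<in> f" "a \<notin> path_image (\<gamma> e)"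
        using interior_arc_image_empty[OF arc_edge[OF e(1)] face_open[OF S f]] by blast
      then obtain g where "g \<in> faces (insert e S)" "a \<in> g" using in_new f by blast
      then show "f \<in> \<pi> ` faces (insert e S)" using \<pi>_eq f a by blast
    qed
  qed
  then show le: "card (faces S) \<le> card (faces (insert e S))" using card_image_le[OF fin] by metis
  assume pc: "path_component (K S) (pathstart (\<gamma> e)) (pathfinish (\<gamma> e))"
  obtain C where C: "C \<in> faces S" "body e \<subseteq> C"
    using connected_in_face[OF connected_body[OF e(1)]] body_Int_K[OF e(1) S e(2)] body_nonempty[OF e(1)] by blast
  obtain x where x: "x \<in> body e" using body_nonempty[OF e(1)] by blast
  have xC: "x \<in> C" "x \<in> path_image (\<gamma> e)" using x C unfolding body_def by auto
  obtain a b where ab: "a \<in> C" "b \<in> C" "a \<notin> path_image (\<gamma> e)" "b \<notin> path_image (\<gamma> e)"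
    "\<not> connected_component (- K (insert e S)) a b"
    using arc_separates[OF compact_K[OF S] arc_edge[OF e(1)] image_Int_K_ends[OF e(1) S e(2)] pc _ xC]
      C(1) unfolding faces_def K_insert by blast
  obtain g h where g: "g \<in> faces (insert e S)" "a \<in> g" and h: "h \<in> faces (insert e S)" "b \<in> h"
    using in_new C(1) ab by meson
  have "\<pi> g = \<pi> h" using \<pi>_eq[OF g(1) C(1) g(2) ab(1)] \<pi>_eq[OF h(1) C(1) h(2) ab(2)] by simp
  moreover have "g \<noteq> h" using ab(5) face_conn' g h by blast
  ultimately have "\<not> inj_on \<pi> (faces (insert e S))" using g h by (auto dest: inj_onD)
  then have "card (faces S) \<noteq> card (faces (insert e S))" using surj eq_card_imp_inj_on[OF fin] by metis
  then show "card (faces S) < card (faces (insert e S))" using le by simp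
qed

text \<open>
  The induction keeps a system \<open>R\<close> of representatives of the connected components.
\<close>

lemma euler:
  assumes S: "S \<subseteq> E" and W: "finite W" "\<And>e. e \<in> S \<Longrightarrow> e \<subseteq> W"
  shows "card S + 1 \<le> card W + card (faces S)"
proof -
  \<comment> \<open>The case \<open>x = y\<close> covers vertices without an edge in
    \<open>T\<close>: their points are not in \<open>K T\<close>, where
    \<open>path_component\<close> fails to be reflexive.\<close>
  define conn where "conn T x y \<longleftrightarrow> x = y \<or> path_component (K T) (p x) (p y)" for T x y
  have conn_sym: "conn T x y \<Longrightarrow> conn T y x" for T x y unfolding conn_def using path_component_sym by blast
  have conn_trans: "conn T x y \<Longrightarrow> conn T y z \<Longrightarrow> conn T x z" for T x y z
    unfolding conn_def using path_component_trans by blast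
  have conn_mono: "conn T x y \<Longrightarrow> conn (insert e T) x y" for T x y e
    unfolding conn_def K_insert using path_component_of_subset by blast
  have "finite S" using S finite_E finite_subset by blast
  then have "S \<subseteq> E \<Longrightarrow> (\<And>e. e \<in> S \<Longrightarrow> e \<subseteq> W) \<Longrightarrow> \<exists>R rep. finite R \<and> (\<forall>w \<in> W. rep w \<in> R \<and> conn S w (rep w)) \<and>
    card S + 1 + card R \<le> card W + card (faces S)"
  proof (induction S)
    case empty
    have "- K {} = UNIV" unfolding K_def by simp
    then have "faces {} = {UNIV}"
      unfolding faces_def using connected_UNIV components_eq_sing_iff by (metis UNIV_not_empty)
    then show ?case using W(1) by (intro exI[of _ W] exI[of _ id]) (auto simp: conn_def)
  next
    case (insert e S)
    then have S: "S \<subseteq> E" and e: "e \<in> E" "e \<notin> S" "e \<subseteq> W" by auto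
    obtain R rep where R: "finite R" "\<And>w. w \<in> W \<Longrightarrow> rep w \<in> R" "\<And>w. w \<in> W \<Longrightarrow> conn S w (rep w)"
      and le: "card S + 1 + card R \<le> card W + card (faces S)" using insert.IH[OF S] insert.prems(2) by blast
    have cI: "card (insert e S) = Suc (card S)" using insert by simp
    obtain x y where xy: "x \<in> e" "y \<in> e" "p x = pathstart (\<gamma> e)" "p y = pathfinish (\<gamma> e)"
      using ends[OF e(1)] by (metis imageE insertI1 insertI2)
    have pne: "p x \<noteq> p y" using arc_distinct_ends[OF arc_edge[OF e(1)]] xy by metis
    have xW: "x \<in> W" "y \<in> W" using xy e by auto
    show ?case
    proof (cases "rep x = rep y")
      case True
      have "conn S x y" using conn_trans[OF R(3)[OF xW(1), unfolded True] conn_sym[OF R(3)[OF xW(2)]]] .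
      then have "path_component (K S) (pathstart (\<gamma> e)) (pathfinish (\<gamma> e))"
        using pne xy unfolding conn_def by auto
      then have "card (faces S) < card (faces (insert e S))" using faces_insert(2)[OF S e(1,2)] by blast
      then show ?thesis using R le cI conn_mono by (intro exI[of _ R] exI[of _ rep]) auto
    next
      case False
      have "path_component (K (insert e S)) (p x) (p y)"
        unfolding path_component_def xy K_insert using arc_imp_path[OF arc_edge[OF e(1)]] by blast
      then have cxy: "conn (insert e S) x y" unfolding conn_def by blast
      \<comment> \<open>The new edge merges two components: \<open>rep x\<close> takes over and
        \<open>rep y\<close> leaves \<open>R\<close>, which pays for the edge without a new
        face.\<close>
      let ?rep = "\<lambda>w. if rep w = rep y then rep x else rep w"
      have "?rep w \<in> R - {rep y} \<and> conn (insert e S) w (?rep w)" if w: "w \<in> W" for w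
      proof (cases "rep w = rep y")
        case True
        have "conn (insert e S) w y" using conn_trans[OF R(3)[OF w] conn_sym[OF R(3)[OF xW(2), folded True]]] conn_mono by blast
        then have "conn (insert e S) w (rep x)"
          using conn_trans conn_sym[OF cxy] conn_mono[OF R(3)[OF xW(1)]] by blast
        then show ?thesis using True False R(2)[OF xW(1)] by auto
      next
        case False
        then show ?thesis using R(2,3)[OF w] conn_mono by auto
      qed
      moreover have "card (R - {rep y}) + 1 = card R" using card.remove[OF R(1) R(2)[OF xW(2)]] by simp
      moreover have "card (faces S) \<le> card (faces (insert e S))" using faces_insert(1)[OF S e(1,2)] .
      ultimately show ?thesis using R(1) le cI by (intro exI[of _ "R - {rep y}"] exI[of _ ?rep]) auto
    qed
  qed
  then obtain R :: "'a set" where "card S + 1 + card R \<le> card W + card (faces S)" using S W(2) by blast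
  then show ?thesis by simp
qed

section \<open>Counting edges on boundaries\<close>

lemma card_edge:
  assumes e: "e \<in> E"
  shows "card e = 2"
proof -
  have "card (p ` e) = card {pathstart (\<gamma> e), pathfinish (\<gamma> e)}" using ends[OF e] by simp
  also have "\<dots> = 2" using arc_distinct_ends[OF arc_edge[OF e]] by auto
  finally show ?thesis using card_image[OF inj_on_subset[OF inj_p edge_subset[OF e]]] by simp
qed

lemma vertex_on_edge:
  assumes "e \<in> E" "v \<in> V"
  shows "p v \<in> path_image (\<gamma> e) \<longleftrightarrow> v \<in> e"
  using on_V[OF assms(1)] inj_on_image_mem_iff[OF inj_p assms(2) edge_subset[OF assms(1)]] assms(2) by blast

text \<open>Double counting: every edge is on the boundary of at most two faces.\<close>

lemma sum_bd_le:
  assumes S: "S \<subseteq> E"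
  shows "(\<Sum>f\<in>faces S. card (bd S f)) \<le> 2 * card S"
proof -
  have fin: "finite S" using S finite_E finite_subset by blast
  have bd: "bd S f = {e \<in> S. e \<in> bd S f}" for f unfolding bd_def by blast
  have "(\<Sum>f\<in>faces S. card (bd S f)) = (\<Sum>f\<in>faces S. card {e \<in> S. e \<in> bd S f})" using bd by simp
  also have "\<dots> = (\<Sum>e\<in>S. card {f \<in> faces S. e \<in> bd S f})"
    by (rule sum_multicount_gen[OF finite_faces[OF S] fin]) simp
  also have "\<dots> \<le> (\<Sum>e\<in>S. 2)" using edge_two_faces(2)[OF S] by (rule sum_mono)
  finally show ?thesis by simp
qed

text \<open>The new arc meets the old drawing in at most one point, a connected set, so
  Janiszewski's theorem applies.\<close>

lemma connected_insert_edge: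
  assumes S: "S \<subseteq> E" and e: "e \<in> E" "e \<notin> S" and one: "e \<inter> \<Union>S \<subseteq> {v}"
    and ab: "connected_component (- K S) a b" "a \<notin> path_image (\<gamma> e)" "b \<notin> path_image (\<gamma> e)"
  shows "connected_component (- K (insert e S)) a b"
proof -
  have "connected (- path_image (\<gamma> e))" using arc_edge[OF e(1)] by (rule connected_arc_complement) simp
  then have 1: "connected_component (- path_image (\<gamma> e)) a b"
    using ab by (intro connected_componentI[of "- path_image (\<gamma> e)"]) auto
  have "path_image (\<gamma> e) \<inter> K S \<subseteq> {p v}" using image_Int_K[OF e(1) S e(2)] one by blast
  then have "connected_component (- (path_image (\<gamma> e) \<union> K S)) a b"
    using Janiszewski[OF compact_arc_image[OF arc_edge[OF e(1)]] closed_K[OF S] connected_subset_singleton 1 ab(1)]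
    by blast
  then show ?thesis unfolding K_insert by (simp add: Un_commute)
qed

lemma face_near:
  assumes S: "S \<subseteq> E" "f \<in> faces S" and U: "open U" "U \<inter> closure f \<noteq> {}"
  obtains a where "a \<in> f" "a \<in> U" "a \<notin> p ` V"
proof -
  have "U \<inter> f \<noteq> {}" using U open_Int_closure_eq_empty by blast
  moreover have "open (U \<inter> f)" using U face_open[OF S] by blast
  ultimately have "infinite (U \<inter> f)" using finite_imp_not_open by blast
  then have "\<not> U \<inter> f \<subseteq> p ` V" using finite_V finite_subset by blast
  then show ?thesis using that by blast
qed

text \<open>
  If at most one edge at \<open>v\<close> were on the boundary of \<open>f\<close>, then removing the other edges at \<open>v\<close> would
  merge \<open>f\<close> with the inner points of a removed edge, as a pendant arc does not separate the points
  near \<open>p v\<close>.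
\<close>

lemma boundary_vertex:
  assumes S: "S \<subseteq> E" "f \<in> faces S" and v: "v \<in> V" "p v \<in> closure f"
    and deg: "2 \<le> card {e \<in> S. v \<in> e}"
  shows "2 \<le> card {e \<in> bd S f. v \<in> e}"
proof (rule ccontr)
  define M N where "M = {e \<in> S. v \<in> e}" and "N = {e \<in> bd S f. v \<in> e}"
  assume "\<not> 2 \<le> card {e \<in> bd S f. v \<in> e}"
  then have N1: "card N \<le> 1" unfolding N_def by simp
  have NM: "N \<subseteq> M" unfolding N_def M_def bd_def by blast
  have finM: "finite M" using S(1) finite_E finite_subset unfolding M_def by (metis (no_types, lifting) mem_Collect_eq subsetI)
  have finN: "finite N" using NM finM finite_subset by blast
  have "\<not> M \<subseteq> N" using card_mono[OF finN, of M] N1 deg unfolding M_def by linarith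
  then obtain g where g: "g \<in> S" "v \<in> g" "g \<notin> N" unfolding M_def by blast
  have gE: "g \<in> E" using g S by blast
  have SM: "S - M \<subseteq> E" using S by blast
  have "p v \<notin> K (S - M)"
    using vertex_on_edge[OF _ v(1)] S(1) unfolding K_def M_def by blast
  \<comment> \<open>With the edges at \<open>v\<close> removed, a disc around \<open>p v\<close> is
    free. It joins a point \<open>a\<close> of \<open>f\<close> to an inner point \<open>b\<close>
    of \<open>g\<close>.\<close>
  then obtain r where r: "0 < r" "ball (p v) r \<subseteq> - K (S - M)"
    using open_contains_ball[of "- K (S - M)"] closed_K[OF SM] by (auto simp: open_Compl)
  have pc: "p v \<in> ball (p v) r" using r by simp
  obtain a where a: "a \<in> f" "a \<in> ball (p v) r" "a \<notin> p ` V"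
    using face_near[OF S open_ball] v(2) pc by blast
  have "p v \<in> closure (body g)" using closure_body[OF gE] vertex_on_edge[OF gE v(1)] g(2) by blast
  then obtain b where b: "b \<in> body g" "b \<in> ball (p v) r"
    using open_Int_closure_eq_empty[OF open_ball, of "p v" r "body g"] pc by blast
  have ab: "connected_component (- K (S - M)) a b"
    using r(2) a b by (intro connected_componentI[of "ball (p v) r"]) auto
  have D: "connected_component (- K ((S - M) \<union> N)) a b"
  proof (cases "N = {}")
    case True
    then show ?thesis using ab by simp
  next
    case False
    then have "card N = 1" using N1 finN by (metis card_0_eq le_antisym less_one not_less)
    then obtain e where e: "N = {e}" using card_1_singletonE by blast
    have eS: "e \<in> S" "v \<in> e" "e \<in> M" using e NM unfolding M_def by auto
    have eE: "e \<in> E" using eS S by blast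
    obtain w where w: "e - {v} = {w}"
      using card_edge[OF eE] eS(2) by (metis card_1_singletonE card_Diff_singleton diff_add_inverse one_add_one)
    have "e \<inter> \<Union>(S - M) \<subseteq> e - {v}" unfolding M_def by blast
    then have one: "e \<inter> \<Union>(S - M) \<subseteq> {w}" unfolding w .
    have "a \<notin> path_image (\<gamma> e)" using a(1) face_subset[OF S(2)] eS(1) unfolding K_def by blast
    moreover have "b \<notin> path_image (\<gamma> e)"
      using body_Int_K[OF gE, of "{e}"] eE b(1) g(3) e unfolding K_def by blast
    ultimately have "connected_component (- K (insert e (S - M))) a b"
      using connected_insert_edge[OF SM eE _ one ab] eS(3) by blast
    then show ?thesis unfolding e by simp
  qed
  have "bd S f \<subseteq> (S - M) \<union> N" "(S - M) \<union> N \<subseteq> E" using S NM unfolding M_def N_def bd_def by blast+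
  moreover have "b \<notin> p ` V" using b unfolding body_def by blast
  ultimately have "b \<in> f" using face_spread[OF S _ _ D a(1,3)] by blast
  then show False using b(1) body_subset_K[OF g(1)] face_subset[OF S(2)] by blast
qed

end

subsection \<open>Edge bounds for bipartite drawings\<close>

locale bipartite_drawing = arc_drawing "A \<union> B" p E \<gamma>
  for A B :: "'a set" and p E \<gamma> +
  assumes disjoint: "A \<inter> B = {}"
    and edgeE: "e \<in> E \<Longrightarrow> \<exists>u \<in> A. \<exists>v \<in> B. e = {u, v}"
begin

lemma finite_AB: "finite A" "finite B"
  using finite_V by auto

text \<open>A bipartite cycle has at least four edges, so these edges form a forest, which has a
  pendant edge. If there were none, \<open>e\<close> would extend on both sides to a path
  \<open>e1\<close>, \<open>e\<close>, \<open>e2\<close> that uses up all the edges, and the free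
  end of \<open>e1\<close> would be pendant after all.\<close>

lemma leaf_edge:
  assumes S: "S \<subseteq> E" "S \<noteq> {}" "card S \<le> 3"
  shows "\<exists>e \<in> S. \<exists>v. e \<inter> \<Union>(S - {e}) \<subseteq> {v}"
proof (rule ccontr)
  assume "\<not> ?thesis"
  then have no: "\<not> e \<inter> \<Union>(S - {e}) \<subseteq> {v}" if "e \<in> S" for e v using that by blast
  have fin: "finite S" using S finite_E finite_subset by blast
  have cov: "\<exists>e' \<in> S. e' \<noteq> e \<and> x \<in> e'" if e: "e \<in> S" "x \<in> e" for e x
  proof (rule ccontr)
    assume nx: "\<not> ?thesis"
    obtain u v where uv: "e = {u, v}" using edgeE e S by blast
    have "x = u \<or> x = v" using e uv by blast
    moreover have "x \<notin> \<Union>(S - {e})" using nx by blast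
    ultimately have "e \<inter> \<Union>(S - {e}) \<subseteq> {u} \<or> e \<inter> \<Union>(S - {e}) \<subseteq> {v}" using uv by blast
    then show False using no[OF e(1)] by blast
  qed
  obtain e where e: "e \<in> S" using S by blast
  obtain u v where uv: "u \<in> A" "v \<in> B" "e = {u, v}" using edgeE e S by blast
  have nAB: "x \<noteq> y" if "x \<in> A" "y \<in> B" for x y using that disjoint by blast
  obtain e1 where e1: "e1 \<in> S" "e1 \<noteq> e" "u \<in> e1" using cov[OF e, of u] uv by auto
  obtain e2 where e2: "e2 \<in> S" "e2 \<noteq> e" "v \<in> e2" using cov[OF e, of v] uv by auto
  obtain u1 v1 where e1': "u1 \<in> A" "v1 \<in> B" "e1 = {u1, v1}" using edgeE[of e1] e1 S by blast
  obtain u2 v2 where e2': "u2 \<in> A" "v2 \<in> B" "e2 = {u2, v2}" using edgeE[of e2] e2 S by blast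
  have 1: "u1 = u" "v2 = v" using e1(3) e2(3) e1' e2' uv nAB[of u v1] nAB[of u2 v] by auto
  have 2: "v1 \<noteq> v" "u2 \<noteq> u" using e1(2) e2(2) e1'(3) e2'(3) uv(3) 1 by auto
  have ne: "e1 \<noteq> e2" using 1 2 e1' e2' uv nAB[of u v] nAB[of u2 v1] nAB[of u v1] by (auto simp: doubleton_eq_iff)
  have "card {e, e1, e2} = 3" using ne e1(2) e2(2) by simp
  then have "S = {e, e1, e2}" using card_seteq[OF fin, of "{e, e1, e2}"] e e1(1) e2(1) S(3) by auto
  moreover obtain e3 where "e3 \<in> S" "e3 \<noteq> e1" "v1 \<in> e3" using cov[OF e1(1), of v1] e1' by auto
  ultimately have "v1 \<in> {u, v} \<or> v1 \<in> {u2, v}" using uv(3) e2'(3) 1 by auto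
  then show False using 2(1) nAB[OF uv(1) e1'(2)] nAB[OF e2'(1) e1'(2)] by auto
qed

text \<open>By \<open>leaf_edge\<close> the drawing is built from pendant arcs, none of which
  separates points.\<close>

lemma connected_few_edges:
  assumes "S \<subseteq> E" "card S \<le> 3"
  shows "connected (- K S)"
  using assms
proof (induction "card S" arbitrary: S)
  case 0
  then have "S = {}" using finite_E finite_subset by (metis card_eq_0_iff)
  then show ?case unfolding K_def by (simp add: connected_UNIV)
next
  case (Suc n)
  obtain e v where e: "e \<in> S" "e \<inter> \<Union>(S - {e}) \<subseteq> {v}"
    using leaf_edge[OF Suc.prems(1) _ Suc.prems(2)] Suc.hyps(2) by (metis card.empty nat.distinct(1))
  have S0: "S - {e} \<subseteq> E" "e \<in> E" "e \<notin> S - {e}" "insert e (S - {e}) = S" using Suc.prems e by auto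
  have "finite S" using Suc.prems(1) finite_E finite_subset by blast
  then have "connected (- K (S - {e}))" using Suc.hyps Suc.prems e S0(1) by simp
  then have c: "connected_component (- K (S - {e})) a b" if "a \<notin> K S" "b \<notin> K S" for a b
    using that K_mono[of "S - {e}" S] by (intro connected_componentI[of "- K (S - {e})"]) auto
  have "connected_component (- K S) a b" if "a \<notin> K S" "b \<notin> K S" for a b
    using connected_insert_edge[OF S0(1,2,3) e(2) c[OF that]] that e(1) unfolding S0(4) K_def by blast
  then show ?case unfolding connected_iff_connected_component by blast
qed

text \<open>At most three boundary edges would not separate the plane, and then they would be all of
  \<open>S\<close>.\<close>

lemma four_bd:
  assumes S: "S \<subseteq> E" "4 \<le> card S" "f \<in> faces S"
  shows "4 \<le> card (bd S f)"
proof (rule ccontr)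
  assume less: "\<not> ?thesis"
  moreover have "bd S f \<subseteq> E" using S unfolding bd_def by blast
  ultimately have "connected (- K (bd S f))" by (intro connected_few_edges) auto
  then have "bd S f = S" using bd_eq_if_connected S by blast
  then show False using less S(2) by simp
qed

text \<open>From \<open>four_bd\<close> and double counting, twice the number of faces is at most
  \<open>card E\<close>; Euler's inequality does the rest. With fewer than four edges the bound
  holds because both sides are nonempty as soon as there is an edge.\<close>

lemma edges_le:
  "card E \<le> 2 * (card A + card B)"
proof (cases "4 \<le> card E")
  case True
  have "(\<Sum>f\<in>faces E. 4) \<le> (\<Sum>f\<in>faces E. card (bd E f))" using four_bd[OF order_refl True] by (rule sum_mono)
  then have "4 * card (faces E) \<le> 2 * card E" using sum_bd_le[OF order_refl] by simp
  moreover have "card E + 1 \<le> card (A \<union> B) + card (faces E)" using euler[OF order_refl finite_V] edge_subset by blast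
  moreover have "card (A \<union> B) \<le> card A + card B" by (rule card_Un_le)
  ultimately show ?thesis by simp
next
  case False
  show ?thesis
  proof (cases "E = {}")
    case False
    then obtain u v where "u \<in> A" "v \<in> B" using edgeE by blast
    then have "card A > 0" "card B > 0" using finite_AB by (auto simp: card_gt_0_iff)
    then show ?thesis using \<open>\<not> 4 \<le> card E\<close> by simp
  qed simp
qed

text \<open>
  \<open>U\<close> is the outer face. Vertices of \<open>B\<close> of degree at most one account for one edge each; every other
  one has at least two edges on the boundary of the outer face, by \<open>boundary_vertex\<close>.
\<close>

lemma edges_le_outer:
  assumes U: "connected U" "U \<noteq> {}" "U \<inter> K E = {}" and B: "p ` B \<subseteq> closure U"
  shows "card E \<le> 2 * card A + card B"
proof -
  define B' where "B' = {v \<in> B. 2 \<le> card {e \<in> E. v \<in> e}}"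
  define S where "S = {e \<in> E. e \<inter> B' \<noteq> {}}"
  have SE: "S \<subseteq> E" and BB: "B' \<subseteq> B" unfolding S_def B'_def by auto
  have finS: "finite S" and finB: "finite B'" using SE BB finite_E finite_AB finite_subset by blast+
  have SedgeE: "\<exists>u \<in> A. \<exists>v \<in> B'. e = {u, v}" if e: "e \<in> S" for e
  proof -
    obtain u v where uv: "u \<in> A" "v \<in> B" "e = {u, v}" using edgeE e SE by blast
    then have "v \<in> B'" using e BB disjoint unfolding S_def by blast
    then show ?thesis using uv by blast
  qed
  have uniq: "v = w" if "e \<in> E" "v \<in> e" "w \<in> e" "v \<in> B" "w \<in> B" for e v w
    using edgeE[OF that(1)] that disjoint by blast
  have count: "2 * card B' \<le> card T" if T: "T \<subseteq> S" "\<And>v. v \<in> B' \<Longrightarrow> 2 \<le> card {e \<in> T. v \<in> e}" for T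
  proof -
    have finT: "finite T" using T finS finite_subset by blast
    have "(\<Sum>v\<in>B'. 2) \<le> (\<Sum>v\<in>B'. card {e \<in> T. v \<in> e})" using T(2) by (rule sum_mono)
    also have "\<dots> = card (\<Union>v\<in>B'. {e \<in> T. v \<in> e})"
    proof (rule card_UN_disjoint[symmetric])
      show "\<forall>i\<in>B'. \<forall>j\<in>B'. i \<noteq> j \<longrightarrow> {e \<in> T. i \<in> e} \<inter> {e \<in> T. j \<in> e} = {}"
        using uniq T(1) SE BB by blast
    qed (use finB finT in auto)
    also have "\<dots> \<le> card T" using finT by (intro card_mono) auto
    finally show ?thesis by simp
  qed
  have degS: "{e \<in> S. v \<in> e} = {e \<in> E. v \<in> e}" if "v \<in> B'" for v using that unfolding S_def by blast
  have bound: "card S \<le> 2 * card A + card B'"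
  proof (cases "4 \<le> card S")
    case True
    have "U \<inter> K S = {}" using U(3) K_mono[OF SE] by blast
    then obtain f where f: "f \<in> faces S" "U \<subseteq> f" using connected_in_face[OF U(1)] U(2) by blast
    have "2 * card B' \<le> card (bd S f)"
    proof (rule count)
      show "bd S f \<subseteq> S" unfolding bd_def by blast
      fix v assume v: "v \<in> B'"
      show "2 \<le> card {e \<in> bd S f. v \<in> e}"
      proof (rule boundary_vertex[OF SE f(1)])
        show "v \<in> A \<union> B" "p v \<in> closure f" using v BB B closure_mono[OF f(2)] by blast+
        show "2 \<le> card {e \<in> S. v \<in> e}" using v unfolding degS[OF v] B'_def by blast
      qed
    qed
    moreover have "(\<Sum>g\<in>faces S - {f}. 4) \<le> (\<Sum>g\<in>faces S - {f}. card (bd S g))"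
      using four_bd[OF SE True] by (intro sum_mono) blast
    moreover have "(\<Sum>g\<in>faces S. card (bd S g)) = card (bd S f) + (\<Sum>g\<in>faces S - {f}. card (bd S g))"
      by (rule sum.remove[OF finite_faces[OF SE] f(1)])
    moreover have "card (faces S) = Suc (card (faces S - {f}))" by (rule card.remove[OF finite_faces[OF SE] f(1)])
    \<comment> \<open>Every face except \<open>f\<close> contributes four boundary edges, and
      \<open>f\<close> contributes \<open>2 * card B'\<close>; this accounts for the summand 4.
      Euler's inequality, multiplied by 4, then leaves
      \<open>card S \<le> 2 * card A + card B'\<close>.\<close>
    ultimately have "4 * card (faces S) + 2 * card B' \<le> 2 * card S + 4" using sum_bd_le[OF SE] by simp
    moreover have "card S + 1 \<le> card (A \<union> B') + card (faces S)"
    proof (rule euler[OF SE])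
      show "e \<subseteq> A \<union> B'" if "e \<in> S" for e using SedgeE[OF that] by blast
    qed (use finite_AB finB in simp)
    ultimately show ?thesis using card_Un_le[of A B'] by linarith
  next
    case False
    have "2 * card B' \<le> card S"
    proof (rule count)
      show "2 \<le> card {e \<in> S. v \<in> e}" if v: "v \<in> B'" for v using v unfolding degS[OF v] B'_def by blast
    qed simp
    \<comment> \<open>At most three edges leave room for only one vertex of degree two in
      \<open>B\<close>, so \<open>S\<close> is a star with at most \<open>card A\<close>
      edges.\<close>
    then have "card B' \<le> 1" using False by linarith
    moreover have "card S \<le> card A * card B'"
    proof -
      have "S \<subseteq> (\<lambda>(u, v). {u, v}) ` (A \<times> B')" using SedgeE by fast
      then have "card S \<le> card ((\<lambda>(u, v). {u, v}) ` (A \<times> B'))" using finite_AB finB by (intro card_mono) auto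
      also have "\<dots> \<le> card (A \<times> B')" using finite_AB finB by (intro card_image_le) auto
      finally show ?thesis by (simp add: card_cartesian_product)
    qed
    moreover have "card A * card B' \<le> card A * 1" using calculation(1) by (rule mult_le_mono2)
    ultimately show ?thesis by linarith
  qed
  have "card (E - S) \<le> card (B - B')"
  proof -
    have "\<exists>v. v \<in> B - B' \<and> v \<in> e" if e: "e \<in> E - S" for e
    proof -
      obtain u v where "u \<in> A" "v \<in> B" "e = {u, v}" using edgeE e by blast
      then show ?thesis using e unfolding S_def by blast
    qed
    \<comment> \<open>Each edge outside \<open>S\<close> is charged to its end in \<open>B\<close>,
      which has degree at most one, so no vertex is charged twice.\<close>
    then obtain h where h: "\<And>e. e \<in> E - S \<Longrightarrow> h e \<in> B - B' \<and> h e \<in> e" by metis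
    have "inj_on h (E - S)"
    proof (rule inj_onI, rule ccontr)
      fix e e' assume e: "e \<in> E - S" "e' \<in> E - S" "h e = h e'" "e \<noteq> e'"
      have "{e, e'} \<subseteq> {d \<in> E. h e \<in> d}" using e h[of e] h[of e'] by auto
      then have "2 \<le> card {d \<in> E. h e \<in> d}" using card_mono[of "{d \<in> E. h e \<in> d}" "{e, e'}"] finite_E e(4) by simp
      then show False using h[OF e(1)] unfolding B'_def by blast
    qed
    then show ?thesis using h finite_AB by (intro card_inj_on_le[of h]) auto
  qed
  moreover have "card E = card S + card (E - S)" using card_Diff_subset[OF finS SE] card_mono[OF finite_E SE] by linarith
  moreover have "card B = card B' + card (B - B')" using card_Diff_subset[OF finB BB] card_mono[OF finite_AB(2) BB] by linarith
  ultimately show ?thesis using bound by linarith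
qed

end

subsection \<open>Proper orientations of planar graphs\<close>

lemma plane_drawing_bipartite:
  fixes G :: "'a pair_pre_digraph"
  assumes G: "pair_graph G" and draw: "plane_drawing G p \<gamma>"
    and AB: "A \<subseteq> pverts G" "B \<subseteq> pverts G" "A \<inter> B = {}"
  shows "bipartite_drawing A B p ((\<lambda>(u, v). {u, v}) ` (parcs G \<inter> A \<times> B)) \<gamma>"
    and "card ((\<lambda>(u, v). {u, v}) ` (parcs G \<inter> A \<times> B)) = card (parcs G \<inter> A \<times> B)"
proof -
  have finV: "finite (pverts G)"
  proof -
    interpret pair_graph G by fact
    show ?thesis by (rule pair_finite_verts)
  qed
  let ?E = "(\<lambda>(u, v). {u, v}) ` (parcs G \<inter> A \<times> B)"
  have sub: "e \<in> edges_of G" if "e \<in> ?E" for e using that unfolding edges_of_def by blast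
  have el: "\<exists>u \<in> A. \<exists>v \<in> B. e = {u, v}" if "e \<in> ?E" for e using that by auto
  have dr: "inj_on p (pverts G)" "\<And>e. e \<in> edges_of G \<Longrightarrow> arc (\<gamma> e) \<and> {pathstart (\<gamma> e), pathfinish (\<gamma> e)} = p ` e \<and>
        path_image (\<gamma> e) \<inter> p ` pverts G = p ` e"
    "\<And>e f. e \<in> edges_of G \<Longrightarrow> f \<in> edges_of G \<Longrightarrow> e \<noteq> f \<Longrightarrow>
        path_image (\<gamma> e) \<inter> path_image (\<gamma> f) \<subseteq> p ` (e \<inter> f)"
    using draw unfolding plane_drawing_def by blast+
  have V: "A \<union> B \<subseteq> pverts G" using AB by blast
  show "bipartite_drawing A B p ?E \<gamma>"
  proof
    show "finite (A \<union> B)" using V finV finite_subset by blast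
    show "inj_on p (A \<union> B)" using dr(1) V inj_on_subset by blast
    show "A \<inter> B = {}" by fact
  next
    fix e assume e: "e \<in> ?E"
    show eAB: "e \<subseteq> A \<union> B" using el[OF e] by blast
    show "arc (\<gamma> e)" "{pathstart (\<gamma> e), pathfinish (\<gamma> e)} = p ` e" using dr(2)[OF sub[OF e]] by blast+
    have restrict: "X \<inter> Y = Z" if "X \<inter> W = Z" "Z \<subseteq> Y" "Y \<subseteq> W" for W X Y Z :: "complex set"
      using that by blast
    show "path_image (\<gamma> e) \<inter> p ` (A \<union> B) = p ` e"
    proof (rule restrict)
      show "path_image (\<gamma> e) \<inter> p ` pverts G = p ` e" using dr(2)[OF sub[OF e]] by blast
      show "p ` e \<subseteq> p ` (A \<union> B)" by (rule image_mono[OF eAB])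
      show "p ` (A \<union> B) \<subseteq> p ` pverts G" by (rule image_mono[OF V])
    qed
    show "\<exists>u \<in> A. \<exists>v \<in> B. e = {u, v}" using el[OF e] .
  next
    fix e f assume "e \<in> ?E" "f \<in> ?E" "e \<noteq> f"
    then show "path_image (\<gamma> e) \<inter> path_image (\<gamma> f) \<subseteq> p ` (e \<inter> f)" by (intro dr(3) sub)
  qed
  show "card ?E = card (parcs G \<inter> A \<times> B)"
  proof (rule card_image, rule inj_onI)
    fix x y assume x: "x \<in> parcs G \<inter> A \<times> B" and y: "y \<in> parcs G \<inter> A \<times> B"
      and eq: "(\<lambda>(u, v). {u, v}) x = (\<lambda>(u, v). {u, v}) y"
    have "fst x \<noteq> snd y" using x y AB(3) by auto
    then show "x = y" using eq by (cases x; cases y) (auto simp: doubleton_eq_iff)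
  qed
qed

lemma planar_arcs_le:
  fixes G :: "'a pair_pre_digraph"
  assumes "pair_graph G" "planar G" "A \<subseteq> pverts G" "B \<subseteq> pverts G" "A \<inter> B = {}"
  shows "card (parcs G \<inter> A \<times> B) \<le> 2 * (card A + card B)"
proof -
  obtain p \<gamma> where "plane_drawing G p \<gamma>" using assms(2) unfolding planar_def by blast
  from bipartite_drawing.edges_le[OF plane_drawing_bipartite(1)[OF assms(1) this assms(3-5)]]
    plane_drawing_bipartite(2)[OF assms(1) this assms(3-5)]
  show ?thesis by simp
qed

text \<open>The outer face of the whole drawing serves as \<open>U\<close>: it avoids the smaller
  drawing of the bipartite subgraph, and all vertices lie in its closure.\<close>

lemma outerplanar_arcs_le:
  fixes G :: "'a pair_pre_digraph"
  assumes G: "pair_graph G" "outerplanar G" and AB: "A \<subseteq> pverts G" "B \<subseteq> pverts G" "A \<inter> B = {}"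
  shows "card (parcs G \<inter> A \<times> B) \<le> 2 * card A + card B"
proof -
  interpret pair_graph G by fact
  obtain p \<gamma> where draw: "plane_drawing G p \<gamma>"
    and outer: "p ` pverts G \<subseteq> frontier (outside (drawing_image G p \<gamma>))"
    using assms(2) unfolding outerplanar_def by blast
  let ?E = "(\<lambda>(u, v). {u, v}) ` (parcs G \<inter> A \<times> B)"
  let ?U = "outside (drawing_image G p \<gamma>)"
  interpret bipartite_drawing A B p ?E \<gamma> by (rule plane_drawing_bipartite(1)[OF G(1) draw AB])
  have "finite (edges_of G)" unfolding edges_of_def using pair_finite_arcs by simp
  moreover have "bounded (path_image (\<gamma> e))" if "e \<in> edges_of G" for e
    using that draw bounded_arc_image unfolding plane_drawing_def by blast
  ultimately have "bounded (drawing_image G p \<gamma>)"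
    unfolding drawing_image_def using pair_finite_verts by (auto simp: bounded_UN finite_imp_bounded)
  then have "connected ?U" "?U \<noteq> {}" by (auto simp: connected_outside outside_bounded_nonempty)
  moreover have "?U \<inter> K ?E = {}"
  proof -
    have "K ?E \<subseteq> drawing_image G p \<gamma>" unfolding K_def drawing_image_def edges_of_def by blast
    then show ?thesis using outside_no_overlap by blast
  qed
  moreover have "p ` B \<subseteq> closure ?U" using outer AB(2) unfolding frontier_def by blast
  ultimately show ?thesis using edges_le_outer plane_drawing_bipartite(2)[OF G(1) draw AB] by simp
qed

lemma out_degree_card_Image: "out_degree (with_proj D) v = card (parcs D `` {v})"
proof -
  have "out_arcs (with_proj D) v = Pair v ` (parcs D `` {v})" unfolding out_arcs_def by auto
  then show ?thesis unfolding out_degree_def by (simp add: card_image inj_on_def)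
qed

lemma proper_orientation_number_le:
  fixes G :: "'a pair_pre_digraph"
  assumes G: "pair_graph G" "colorable 3 G"
    and sparse: "\<And>X1 X2 X3. X1 \<subseteq> pverts G \<Longrightarrow> X2 \<subseteq> pverts G \<Longrightarrow> X3 \<subseteq> pverts G \<Longrightarrow>
      X1 \<inter> X2 = {} \<Longrightarrow> X1 \<inter> X3 = {} \<Longrightarrow> X2 \<inter> X3 = {} \<Longrightarrow>
      card (parcs G \<inter> (X1 \<union> X2) \<times> X3) + card (parcs G \<inter> X2 \<times> X1) \<le>
        (k + 2) * card X1 + 4 * card X2 + k * card X3"
  shows "proper_orientation_number G \<le> k + 8"
proof -
  interpret pair_graph G by fact
  obtain c :: "'a \<Rightarrow> nat" where c: "\<And>v. v \<in> pverts G \<Longrightarrow> c v < 3" "\<And>u v. (u, v) \<in> parcs G \<Longrightarrow> c u \<noteq> c v"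
    using G(2) unfolding colorable_def by blast
  define V where "V i = {v \<in> pverts G. c v = i}" for i
  have un: "V 0 \<union> V 1 \<union> V 2 = pverts G" using c(1) unfolding V_def by (auto simp: numeral_3_eq_3 less_Suc_eq numeral_2_eq_2)
  have fin: "finite (V i)" for i using pair_finite_verts unfolding V_def by simp
  have disj: "V i \<inter> V j = {}" if "i \<noteq> j" for i j using that unfolding V_def by auto
  have ind: "parcs G \<inter> V i \<times> V i = {}" for i
  proof -
    have "c u = c v" if "u \<in> V i" "v \<in> V i" for u v using that unfolding V_def by simp
    then show ?thesis using c(2) by auto
  qed
  have "parcs G \<subseteq> pverts G \<times> pverts G" using in_arcsD1 in_arcsD2 by auto
  moreover have "sym (parcs G)" using pair_sym_arcs unfolding symmetric_def by simp
  ultimately have "\<exists>D. orients (parcs G) D \<and> (\<forall>v \<in> V 0 \<union> V 1 \<union> V 2. card (D `` {v}) \<le> k + 8) \<and>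
    (\<forall>(u, v) \<in> parcs G. card (D `` {u}) \<noteq> card (D `` {v}))"
  proof (intro proper_orientation_of_sparse)
    fix X1 X2 X3 assume X: "X1 \<subseteq> V 0" "X2 \<subseteq> V 1" "X3 \<subseteq> V 2"
    show "card (parcs G \<inter> (X1 \<union> X2) \<times> X3) + card (parcs G \<inter> X2 \<times> X1) \<le>
        (k + 2) * card X1 + 4 * card X2 + k * card X3"
    proof (rule sparse)
      show "X1 \<subseteq> pverts G" "X2 \<subseteq> pverts G" "X3 \<subseteq> pverts G" using X unfolding V_def by blast+
      show "X1 \<inter> X2 = {}" "X1 \<inter> X3 = {}" "X2 \<inter> X3 = {}"
        using X disj[of 0 1] disj[of 0 2] disj[of 1 2] by auto
    qed
  qed (use fin disj ind un in auto)
  then obtain D where D: "orients (parcs G) D" "\<And>v. v \<in> pverts G \<Longrightarrow> card (D `` {v}) \<le> k + 8"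
    "\<And>u v. (u, v) \<in> parcs G \<Longrightarrow> card (D `` {u}) \<noteq> card (D `` {v})" unfolding un by blast
  let ?D = "\<lparr>pverts = pverts G, parcs = D\<rparr>"
  have "proper_orientation G ?D"
    using D(1,3) unfolding proper_orientation_def orientation_of_def orients_def out_degree_card_Image by auto
  then have "proper_orientation_number G \<le> max_out_degree ?D"
    unfolding proper_orientation_number_def by (intro Least_le) blast
  also have "\<dots> \<le> k + 8"
    unfolding max_out_degree_def out_degree_card_Image using D(2) pair_finite_verts by (subst Max_le_iff) auto
  finally show ?thesis .
qed

theorem theorem1p5:
  fixes G :: "'a pair_pre_digraph"
  assumes "pair_graph G"
    and "colorable 3 G"
    and "planar G"
  shows "proper_orientation_number G \<le> 10 \<and>
    (outerplanar G \<longrightarrow> proper_orientation_number G \<le> 9)"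
proof
  interpret pair_graph G by fact
  have un: "card (X1 \<union> X2) = card X1 + card X2"
    if "X1 \<subseteq> pverts G" "X2 \<subseteq> pverts G" "X1 \<inter> X2 = {}" for X1 X2
    using that pair_finite_verts by (meson card_Un_disjoint finite_subset)
  have "proper_orientation_number G \<le> 2 + 8"
  proof (rule proper_orientation_number_le[OF assms(1,2)])
    fix X1 X2 X3 assume X: "X1 \<subseteq> pverts G" "X2 \<subseteq> pverts G" "X3 \<subseteq> pverts G"
      "X1 \<inter> X2 = {}" "X1 \<inter> X3 = {}" "X2 \<inter> X3 = {}"
    have "card (parcs G \<inter> (X1 \<union> X2) \<times> X3) \<le> 2 * (card (X1 \<union> X2) + card X3)"
      by (rule planar_arcs_le[OF assms(1,3)]) (use X in auto)
    moreover have "card (parcs G \<inter> X2 \<times> X1) \<le> 2 * (card X2 + card X1)"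
      by (rule planar_arcs_le[OF assms(1,3)]) (use X in auto)
    ultimately show "card (parcs G \<inter> (X1 \<union> X2) \<times> X3) + card (parcs G \<inter> X2 \<times> X1) \<le>
        (2 + 2) * card X1 + 4 * card X2 + 2 * card X3" using un[OF X(1,2,4)] by simp
  qed
  then show "proper_orientation_number G \<le> 10" by simp
  show "outerplanar G \<longrightarrow> proper_orientation_number G \<le> 9"
  proof
    assume outer: "outerplanar G"
    have "proper_orientation_number G \<le> 1 + 8"
    proof (rule proper_orientation_number_le[OF assms(1,2)])
      fix X1 X2 X3 assume X: "X1 \<subseteq> pverts G" "X2 \<subseteq> pverts G" "X3 \<subseteq> pverts G"
        "X1 \<inter> X2 = {}" "X1 \<inter> X3 = {}" "X2 \<inter> X3 = {}"
      \<comment> \<open>The bound charges 2 to the first set and 1 to the second, so the order of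
        the sets matters: \<open>X3\<close> is charged 1, \<open>X1\<close> is charged 2 + 1 and
        \<open>X2\<close> is charged 2 + 2.\<close>
      have "card (parcs G \<inter> (X1 \<union> X2) \<times> X3) \<le> 2 * card (X1 \<union> X2) + card X3"
        by (rule outerplanar_arcs_le[OF assms(1) outer]) (use X in auto)
      moreover have "card (parcs G \<inter> X2 \<times> X1) \<le> 2 * card X2 + card X1"
        by (rule outerplanar_arcs_le[OF assms(1) outer]) (use X in auto)
      ultimately show "card (parcs G \<inter> (X1 \<union> X2) \<times> X3) + card (parcs G \<inter> X2 \<times> X1) \<le>
          (1 + 2) * card X1 + 4 * card X2 + 1 * card X3" using un[OF X(1,2,4)] by simp
    qed
    then show "proper_orientation_number G \<le> 9" by simp
  qed
qed

end
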